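(* Let $s, t \geq 2$ be integers. Every $\mathcal{J}_{s,t}$-minor-free graph $G$ is isomorphic to a subgraph of $H \boxtimes K_m$ for some graph $H$ with $\mathrm{tw}(H) \leq s$, where $m := (\mathrm{tw}(G)+1)(t-1)$.
   Context: All graphs are finite, simple and undirected. $\mathrm{tw}$ denotes treewidth. $\mathcal{J}_{s,t}$ is the class of graphs whose vertex-set has a partition $A \cup B$ with $|A| = s$, $|B| = t$, $A$ a clique, every vertex of $A$ adjacent to every vertex of $B$, and $G[B]$ connected; $\mathcal{J}_{s,t}$-minor-free means containing no graph of $\mathcal{J}_{s,t}$ as a minor. The strong product $A \boxtimes B$ has vertex-set $V(A)\times V(B)$, where distinct $(v,x),(w,y)$ are adjacent if ($v=w$ and $xy\in E(B)$), or ($x=y$ and $vw\in E(A)$), or ($vw\in E(A)$ and $xy\in E(B)$). $K_m$ is the complete graph on $m$ vertices. *)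

theory Defs
  imports "Graph_Theory.Graph_Theory"
begin

text \<open>
  A finite simple undirected graph is a \<^locale>\<open>pair_graph\<close>: a finite, loop-free, symmetric
  digraph without parallel arcs, the edge \<open>uv\<close> being the pair of arcs \<open>(u,v)\<close>, \<open>(v,u)\<close>.
\<close>

definition complete_graph :: "nat \<Rightarrow> nat pair_pre_digraph" where
  "complete_graph m = \<lparr>pverts = {..<m}, parcs = {(i, j). i < m \<and> j < m \<and> i \<noteq> j}\<rparr>"

definition strong_product ::
    "'a pair_pre_digraph \<Rightarrow> 'b pair_pre_digraph \<Rightarrow> ('a \<times> 'b) pair_pre_digraph"
    (infixl \<open>\<boxtimes>\<close> 70) where
  "A \<boxtimes> B = \<lparr>
     pverts = pverts A \<times> pverts B,
     parcs = {((v, x), (w, y)).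
       (v, x) \<in> pverts A \<times> pverts B \<and> (w, y) \<in> pverts A \<times> pverts B \<and> (v, x) \<noteq> (w, y) \<and>
       (v = w \<and> (x, y) \<in> parcs B \<or>
        x = y \<and> (v, w) \<in> parcs A \<or>
        (v, w) \<in> parcs A \<and> (x, y) \<in> parcs B)}\<rparr>"

definition isomorphic_to_subgraph :: "'a pair_pre_digraph \<Rightarrow> 'b pair_pre_digraph \<Rightarrow> bool" where
  "isomorphic_to_subgraph G H \<longleftrightarrow>
     (\<exists>S. subgraph S (with_proj H) \<and> digraph_iso (with_proj G) S)"

text \<open>
  The library's \<^const>\<open>forest\<close> and \<^const>\<open>tree\<close> are not suitable for symmetric digraphs, where the
  two arcs of any edge already form a \<^const>\<open>pre_digraph.cycle\<close> of length 2.  The cycles of the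
  undirected graph are those of length at least 3.
  Note that \<^const>\<open>Digraph_Component.connected\<close> includes non-emptiness.
\<close>

definition undirected_tree :: "'a pair_pre_digraph \<Rightarrow> bool" where
  "undirected_tree T \<longleftrightarrow>
     pair_graph T \<and> Digraph_Component.connected (with_proj T) \<and>
     \<not> (\<exists>p. pre_digraph.cycle (with_proj T) p \<and> 3 \<le> length p)"

definition tree_decomposition ::
    "'a pair_pre_digraph \<Rightarrow> 'b pair_pre_digraph \<Rightarrow> ('b \<Rightarrow> 'a set) \<Rightarrow> bool" where
  "tree_decomposition G T B \<longleftrightarrow>
     undirected_tree T \<and>
     (\<forall>x\<in>pverts T. B x \<subseteq> pverts G) \<and>
     (\<forall>(u, v)\<in>parcs G. \<exists>x\<in>pverts T. u \<in> B x \<and> v \<in> B x) \<and>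
     (\<forall>v\<in>pverts G. Digraph_Component.connected (with_proj T \<restriction> {x \<in> pverts T. v \<in> B x}))"

definition decomposition_width :: "'b pair_pre_digraph \<Rightarrow> ('b \<Rightarrow> 'a set) \<Rightarrow> int" where
  "decomposition_width T B = int (Max ((\<lambda>x. card (B x)) ` pverts T)) - 1"

text \<open>
  Decomposition trees are finite, so it suffices to consider trees on natural numbers.  Treewidth is
  an integer because the graph without vertices has treewidth \<open>-1\<close>.
\<close>

definition treewidth :: "'a pair_pre_digraph \<Rightarrow> int" where
  "treewidth G = (LEAST k. \<exists>(T :: nat pair_pre_digraph) B.
     tree_decomposition G T B \<and> decomposition_width T B = k)"

text \<open>\<open>X\<close> is a minor of \<open>G\<close>, given by branch sets \<open>\<phi> x\<close>.\<close>

definition is_minor :: "'a pair_pre_digraph \<Rightarrow> 'b pair_pre_digraph \<Rightarrow> bool" where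
  "is_minor X G \<longleftrightarrow>
     (\<exists>\<phi>. (\<forall>x\<in>pverts X. \<phi> x \<subseteq> pverts G \<and> Digraph_Component.connected (with_proj G \<restriction> \<phi> x)) \<and>
          (\<forall>x\<in>pverts X. \<forall>y\<in>pverts X. x \<noteq> y \<longrightarrow> \<phi> x \<inter> \<phi> y = {}) \<and>
          (\<forall>(x, y)\<in>parcs X. \<exists>u\<in>\<phi> x. \<exists>v\<in>\<phi> y. (u, v) \<in> parcs G))"

definition J_class :: "nat \<Rightarrow> nat \<Rightarrow> 'a pair_pre_digraph set" where
  "J_class s t = {J. pair_graph J \<and>
     (\<exists>A B. pverts J = A \<union> B \<and> A \<inter> B = {} \<and> card A = s \<and> card B = t \<and>
        (\<forall>u\<in>A. \<forall>v\<in>A. u \<noteq> v \<longrightarrow> (u, v) \<in> parcs J) \<and>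
        (\<forall>u\<in>A. \<forall>v\<in>B. (u, v) \<in> parcs J) \<and>
        Digraph_Component.connected (with_proj J \<restriction> B))}"

text \<open>Up to isomorphism, every finite graph has natural numbers as vertices.\<close>

definition J_minor_free :: "nat \<Rightarrow> nat \<Rightarrow> 'a pair_pre_digraph \<Rightarrow> bool" where
  "J_minor_free s t G \<longleftrightarrow> \<not> (\<exists>J :: nat pair_pre_digraph. J \<in> J_class s t \<and> is_minor J G)"

lemma complete_digraph_complete_graph: "K\<^bsub>m\<^esub> (with_proj (complete_graph m))"
  by (auto simp: complete_digraph_pair_def complete_graph_def)

lemma pair_graph_strong_product:
  assumes "pair_graph A" "pair_graph B"
  shows "pair_graph (A \<boxtimes> B)"
proof -
  interpret A: pair_graph A by fact
  interpret B: pair_graph B by fact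
  have fin: "finite (pverts A \<times> pverts B)"
    using A.pair_finite_verts B.pair_finite_verts by simp
  have "parcs (A \<boxtimes> B) \<subseteq> (pverts A \<times> pverts B) \<times> (pverts A \<times> pverts B)"
    by (auto simp: strong_product_def)
  then have "finite (parcs (A \<boxtimes> B))"
    using fin by (meson finite_SigmaI finite_subset)
  then show ?thesis
    using fin
    by unfold_locales
      (auto simp: strong_product_def symmetric_def intro!: symI
        dest: A.arcs_symmetric B.arcs_symmetric)
qed

lemma trivial_tree_decomposition:
  assumes "pair_graph G"
  shows "tree_decomposition G \<lparr>pverts = {0 :: nat}, parcs = {}\<rparr> (\<lambda>_. pverts G)"
proof -
  interpret pair_graph G by fact
  let ?T = "\<lparr>pverts = {0 :: nat}, parcs = {}\<rparr>"
  interpret T: pair_graph ?T by unfold_locales (auto simp: symmetric_def sym_def)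
  have conn: "Digraph_Component.connected (with_proj ?T)"
    by (auto simp: Digraph_Component.connected_def strongly_connected_def reachable_def
        mk_symmetric_def)
  have "with_proj ?T \<restriction> {0} = with_proj ?T"
    by (auto simp: induce_subgraph_def with_proj_def)
  with conn have "Digraph_Component.connected (with_proj ?T \<restriction> {0})" by (simp only:)
  moreover have "\<not> pre_digraph.cycle (with_proj ?T) p" for p
    by (auto simp: T.cycle_def T.awalk_def)
  ultimately show ?thesis
    using conn T.pair_graph in_arcsD1 in_arcsD2
    by (auto simp: tree_decomposition_def undirected_tree_def)
qed

lemma
  assumes "pair_graph G"
  shows treewidth_attained: "\<exists>(T :: nat pair_pre_digraph) B.
      tree_decomposition G T B \<and> decomposition_width T B = treewidth G"
    and treewidth_le: "\<And>(T :: nat pair_pre_digraph) B.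
      tree_decomposition G T B \<Longrightarrow> treewidth G \<le> decomposition_width T B"
proof -
  define P where "P k \<longleftrightarrow> (\<exists>(T :: nat pair_pre_digraph) B.
    tree_decomposition G T B \<and> decomposition_width T B = k)" for k
  define n where "n = (LEAST n. P (int n - 1))"
  have "P (int (card (pverts G)) - 1)"
    unfolding P_def using trivial_tree_decomposition[OF assms]
    by (force simp: decomposition_width_def)
  then have least: "P (int n - 1)" unfolding n_def by (rule LeastI)
  have le: "int n - 1 \<le> k" if k: "P k" for k
  proof -
    from k have "k \<ge> -1" by (auto simp: P_def decomposition_width_def)
    with k have "n \<le> nat (k + 1)" unfolding n_def by (intro Least_le) simp
    with \<open>k \<ge> -1\<close> show ?thesis by linarith
  qed
  have eq: "treewidth G = int n - 1"
    unfolding treewidth_def P_def[symmetric] using least le by (intro Least_equality) auto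
  show "\<exists>(T :: nat pair_pre_digraph) B.
      tree_decomposition G T B \<and> decomposition_width T B = treewidth G"
    using least unfolding eq P_def .
  show "treewidth G \<le> decomposition_width T B"
    if "tree_decomposition G T B" for T :: "nat pair_pre_digraph" and B
    unfolding eq by (rule le) (use that P_def in blast)
qed

end

theory Submission
  imports Defs
begin

text \<open>
  The parts of \<open>H\<close> are created one after another.  Each component \<open>C\<close> of the vertices not yet used
  sees at most \<open>s\<close> earlier parts, which form a clique in \<open>H\<close>, and its neighbours in these parts lie
  in disjoint, connected, pairwise adjacent branch sets \<open>R\<^sub>i\<close> outside \<open>C\<close>.  The next part \<open>S\<close> is chosen
  in \<open>C\<close>; call a connected subset of \<open>C\<close> full if it is adjacent to all the \<open>R\<^sub>i\<close>.

  If there are \<open>s\<close> branch sets, then \<open>t\<close> disjoint full sets would give a minor in the class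
  \<open>J\<^sub>s\<^sub>,\<^sub>t\<close>, so by the Erdos-Posa property of connected subgraphs \<open>t - 1\<close> bags hit all full sets; \<open>S\<close> is
  a minimal hitting set.  If there are fewer, \<open>S\<close> separates inside \<open>C\<close> a full set \<open>D\<close> such that
  \<open>D - S\<close> contains no full set; part of one bag suffices.  In both cases a component of \<open>C - S\<close>
  either misses some \<open>R\<^sub>i\<close>, and \<open>S\<close> is joined to \<open>R\<^sub>i\<close> by paths in the rest of \<open>C\<close> and takes its place,
  or it avoids \<open>D\<close>, which becomes a new branch set.
\<close>

section \<open>Connectedness by cuts\<close>

definition adjacent :: "'v rel \<Rightarrow> 'v set \<Rightarrow> 'v set \<Rightarrow> bool" where
  "adjacent E A B \<longleftrightarrow> (\<exists>a\<in>A. \<exists>b\<in>B. (a, b) \<in> E)"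

definition conn :: "'v rel \<Rightarrow> 'v set \<Rightarrow> bool" where
  "conn E A \<longleftrightarrow> A \<noteq> {} \<and> (\<forall>X. X \<subseteq> A \<and> X \<noteq> {} \<and> X \<noteq> A \<longrightarrow> adjacent E X (A - X))"

definition component :: "'v rel \<Rightarrow> 'v set \<Rightarrow> 'v set \<Rightarrow> bool" where
  "component E X C \<longleftrightarrow> C \<subseteq> X \<and> conn E C \<and> \<not> adjacent E C (X - C)"

lemma adjacent_sym: "sym E \<Longrightarrow> adjacent E A B \<Longrightarrow> adjacent E B A"
  unfolding adjacent_def sym_def by blast

lemma adjacent_mono: "adjacent E A B \<Longrightarrow> A \<subseteq> A' \<Longrightarrow> B \<subseteq> B' \<Longrightarrow> adjacent E A' B'"
  unfolding adjacent_def by blast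

lemma connD: "conn E A \<Longrightarrow> X \<subseteq> A \<Longrightarrow> X \<noteq> {} \<Longrightarrow> X \<noteq> A \<Longrightarrow> adjacent E X (A - X)"
  unfolding conn_def by blast

lemma conn_singleton: "conn E {v}"
  unfolding conn_def by auto

lemma conn_subset_of_no_exit:
  assumes "conn E A" "A \<inter> K \<noteq> {}" "\<not> adjacent E (A \<inter> K) (A - K)"
  shows "A \<subseteq> K"
proof (rule ccontr)
  assume "\<not> A \<subseteq> K"
  then have "adjacent E (A \<inter> K) (A - A \<inter> K)"
    using assms by (intro connD) auto
  moreover have "A - A \<inter> K = A - K" by blast
  ultimately show False using assms by simp
qed

lemma conn_Un:
  assumes E: "sym E" and A: "conn E A" and B: "conn E B"
    and AB: "A \<inter> B \<noteq> {} \<or> adjacent E A B"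
  shows "conn E (A \<union> B)"
  unfolding conn_def
proof (intro conjI allI impI)
  show "A \<union> B \<noteq> {}" using A by (auto simp: conn_def)
  fix X assume X: "X \<subseteq> A \<union> B \<and> X \<noteq> {} \<and> X \<noteq> A \<union> B"
  show "adjacent E X (A \<union> B - X)"
  proof (rule ccontr)
    assume n: "\<not> ?thesis"
    have nA: "\<not> adjacent E (A \<inter> X) (A - X)" and nB: "\<not> adjacent E (B \<inter> X) (B - X)"
      using n by (auto simp: adjacent_def)
    have "A \<inter> X = {} \<or> A \<subseteq> X" using conn_subset_of_no_exit[OF A _ nA] by blast
    moreover have "B \<inter> X = {} \<or> B \<subseteq> X" using conn_subset_of_no_exit[OF B _ nB] by blast
    ultimately consider "A \<subseteq> X" "B \<inter> X = {}" | "B \<subseteq> X" "A \<inter> X = {}" using X by blast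
    then show False
    proof cases
      case 1
      then have "adjacent E A B" using AB by blast
      then have "adjacent E X (A \<union> B - X)" by (rule adjacent_mono) (use 1 in auto)
      then show False using n by blast
    next
      case 2
      then have "adjacent E B A" using AB adjacent_sym[OF E] by blast
      then have "adjacent E X (A \<union> B - X)" by (rule adjacent_mono) (use 2 in auto)
      then show False using n by blast
    qed
  qed
qed

lemma conn_insert:
  assumes "sym E" "conn E A" "a \<in> A" "(a, v) \<in> E"
  shows "conn E (insert v A)"
  using conn_Un[OF assms(1,2) conn_singleton[of E v]] assms by (auto simp: adjacent_def)

lemma conn_Un_UN:
  assumes E: "sym E" and "finite S" and A: "conn E A"
    and "\<And>v. v \<in> S \<Longrightarrow> conn E (B v)" "\<And>v. v \<in> S \<Longrightarrow> adjacent E (B v) A"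
  shows "conn E (A \<union> (\<Union>v\<in>S. B v))"
  using assms(2,4,5)
proof (induction S)
  case empty
  then show ?case using A by simp
next
  case (insert v S)
  have "conn E ((A \<union> (\<Union>v\<in>S. B v)) \<union> B v)"
  proof (rule conn_Un[OF E])
    show "conn E (A \<union> (\<Union>v\<in>S. B v))" using insert by simp
    show "conn E (B v)" using insert by simp
    have "adjacent E A (B v)" using insert adjacent_sym[OF E] by simp
    then show "(A \<union> (\<Union>v\<in>S. B v)) \<inter> B v \<noteq> {} \<or> adjacent E (A \<union> (\<Union>v\<in>S. B v)) (B v)"
      by (auto simp: adjacent_def)
  qed
  then show ?case by (simp add: Un_ac)
qed

lemma component_ex:
  assumes E: "sym E" and X: "finite X" and A: "conn E A" "A \<subseteq> X"
  obtains C where "component E X C" "A \<subseteq> C"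
proof -
  define P where "P C \<longleftrightarrow> conn E C \<and> A \<subseteq> C \<and> C \<subseteq> X" for C
  have "P A" using A by (simp add: P_def)
  moreover have "\<forall>C. P C \<longrightarrow> card C < Suc (card X)"
    using X by (auto simp: P_def less_Suc_eq_le intro: card_mono)
  ultimately obtain C where C: "P C" and max: "\<And>D. P D \<Longrightarrow> card D \<le> card C"
    using ex_has_greatest_nat[of P A card] by blast
  have "\<not> adjacent E C (X - C)"
  proof
    assume "adjacent E C (X - C)"
    then obtain a b where ab: "a \<in> C" "b \<in> X - C" "(a, b) \<in> E" by (auto simp: adjacent_def)
    then have "P (insert b C)" using C conn_insert[OF E] by (auto simp: P_def)
    moreover have "finite C" using C X by (auto simp: P_def intro: finite_subset)
    ultimately show False using max[of "insert b C"] ab by simp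
  qed
  with C that show thesis by (auto simp: P_def component_def)
qed

lemma conn_subset_component:
  assumes "component E X C" "conn E A" "A \<subseteq> X" "A \<inter> C \<noteq> {}"
  shows "A \<subseteq> C"
proof (rule conn_subset_of_no_exit[OF assms(2,4)])
  show "\<not> adjacent E (A \<inter> C) (A - C)" using assms(1,3) by (auto simp: component_def adjacent_def)
qed

lemma conn_minus_component:
  assumes E: "sym E" and K: "component E (C - S) K"
    and A: "conn E A" "A \<subseteq> C" "A \<inter> S = {v}"
  shows "conn E (A - K)"
proof -
  have v: "v \<in> A" "v \<notin> K" using A K by (auto simp: component_def)
  have *: "adjacent E X (A - K - X)" if X: "X \<subseteq> A - K" "X \<noteq> {}" "v \<notin> X" for X
  proof -
    have "adjacent E X (A - X)" using A X v by (intro connD) auto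
    moreover have "\<not> adjacent E X K"
    proof
      assume "adjacent E X K"
      then have "adjacent E K X" by (rule adjacent_sym[OF E])
      moreover have "x \<notin> S" if "x \<in> X" for x using that X A(3) by auto
      then have "X \<subseteq> C - S - K" using X(1) A(2) by blast
      ultimately have "adjacent E K (C - S - K)" by (rule adjacent_mono[OF _ order_refl])
      then show False using K by (simp add: component_def)
    qed
    ultimately show ?thesis unfolding adjacent_def by blast
  qed
  show ?thesis unfolding conn_def
  proof (intro conjI allI impI)
    show "A - K \<noteq> {}" using v by blast
    fix X assume X: "X \<subseteq> A - K \<and> X \<noteq> {} \<and> X \<noteq> A - K"
    show "adjacent E X (A - K - X)"
    proof (cases "v \<in> X")
      case False
      then show ?thesis using * X by blast
    next
      case True
      have "adjacent E (A - K - X) (A - K - (A - K - X))" using X True by (intro *) auto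
      moreover have "A - K - (A - K - X) = X" using X by blast
      ultimately show ?thesis using adjacent_sym[OF E] by metis
    qed
  qed
qed

lemma connected_iff_conn:
  assumes "sym (parcs G)"
  shows "Digraph_Component.connected (with_proj G \<restriction> A) \<longleftrightarrow> conn (parcs G) A"
proof -
  define r where "r = parcs G \<inter> A \<times> A"
  have "arcs_ends (with_proj G \<restriction> A) = r"
    by (auto simp: arcs_ends_conv induce_subgraph_def r_def image_iff)
  moreover have "r\<^sup>s = r" using assms by (auto simp: symcl_def r_def sym_def image_iff)
  ultimately have lib: "Digraph_Component.connected (with_proj G \<restriction> A) \<longleftrightarrow>
      A \<noteq> {} \<and> (\<forall>u\<in>A. \<forall>v\<in>A. (u, v) \<in> rtrancl_on A r)"
    unfolding connected_conv by simp
  show ?thesis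
  proof
    assume L: "Digraph_Component.connected (with_proj G \<restriction> A)"
    show "conn (parcs G) A" unfolding conn_def
    proof (intro conjI allI impI)
      show "A \<noteq> {}" using L lib by simp
      fix X assume X: "X \<subseteq> A \<and> X \<noteq> {} \<and> X \<noteq> A"
      then obtain u v where uv: "u \<in> X" "v \<in> A - X" by blast
      show "adjacent (parcs G) X (A - X)"
      proof (rule ccontr)
        assume n: "\<not> ?thesis"
        have "(u, v) \<in> rtrancl_on A r" using L lib uv X by blast
        then have "v \<in> X"
          by (induction rule: rtrancl_on_induct) (use uv n in \<open>auto simp: adjacent_def r_def\<close>)
        then show False using uv by blast
      qed
    qed
  next
    assume R: "conn (parcs G) A"
    have "(u, v) \<in> rtrancl_on A r" if "u \<in> A" "v \<in> A" for u v
    proof -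
      define X where "X = {w \<in> A. (u, w) \<in> rtrancl_on A r}"
      have "\<not> adjacent (parcs G) X (A - X)"
        by (auto simp: X_def adjacent_def r_def intro: rtrancl_on_into_rtrancl_on)
      moreover have "u \<in> X" "X \<subseteq> A" using that by (auto simp: X_def)
      ultimately have "X = A" using R connD[of "parcs G" A X] by blast
      then show ?thesis using that X_def by blast
    qed
    then show "Digraph_Component.connected (with_proj G \<restriction> A)"
      using R lib by (auto simp: conn_def)
  qed
qed

lemma induce_subgraph_pverts:
  assumes "pair_wf_digraph G"
  shows "with_proj G \<restriction> pverts G = with_proj G"
proof -
  interpret pair_wf_digraph G by fact
  show ?thesis by (auto simp: induce_subgraph_def with_proj_def dest: in_arcsD1 in_arcsD2)
qed

lemma pair_graph_sym:
  assumes "pair_graph G"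
  shows "sym (parcs G)"
proof -
  interpret pair_graph G by fact
  show ?thesis by (rule symI) (rule arcs_symmetric)
qed

section \<open>Tree decompositions\<close>

lemma pawalk_verts_eq: "pcas u p v \<Longrightarrow> pawalk_verts u p = u # map snd p"
  by (induction p arbitrary: u) auto

lemma pcas_append: "pcas u (p @ q) w \<longleftrightarrow> (\<exists>v. pcas u p v \<and> pcas v q w)"
  by (induction p arbitrary: u) auto

lemma pcas_close: "pcas a p b \<Longrightarrow> pcas x ((x, a) # p @ [(b, x)]) x"
  by (simp add: pcas_append)

lemma conn_apath_inside:
  assumes "pair_graph T" "conn (parcs T) K" "K \<subseteq> pverts T" "a \<in> K" "b \<in> K"
  obtains p where "pre_digraph.awalk (with_proj T) a p b" "distinct (pawalk_verts a p)"
    "set (pawalk_verts a p) \<subseteq> K"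
proof -
  interpret T: pair_graph T by fact
  define X where "X = {w \<in> K. \<exists>p. T.awalk a p w \<and> set p \<subseteq> K \<times> K}"
  have "T.awalk a [] a" using assms by (auto simp: T.awalk_def)
  then have aX: "a \<in> X" using assms(4) by (auto simp: X_def intro!: exI[of _ "[]"])
  have "\<not> adjacent (parcs T) X (K - X)"
  proof
    assume "adjacent (parcs T) X (K - X)"
    then obtain w z where wz: "w \<in> X" "z \<in> K - X" "(w, z) \<in> parcs T"
      by (auto simp: adjacent_def)
    then obtain p where p: "T.awalk a p w" "set p \<subseteq> K \<times> K" by (auto simp: X_def)
    have "T.awalk a (p @ [(w, z)]) z" using p wz by (auto simp: T.awalk_def pcas_append)
    moreover have "set (p @ [(w, z)]) \<subseteq> K \<times> K" using p wz by (auto simp: X_def)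
    ultimately have "z \<in> X" using wz unfolding X_def by blast
    then show False using wz by blast
  qed
  then have "X = K" using connD[OF assms(2), of X] aX by (auto simp: X_def)
  then obtain p where p: "T.awalk a p b" "set p \<subseteq> K \<times> K" using assms(5) by (auto simp: X_def)
  define q where "q = T.awalk_to_apath p"
  have q: "T.apath a q b" using T.apath_awalk_to_apath[OF p(1)] by (simp add: q_def)
  have "set q \<subseteq> K \<times> K" using T.awalk_to_apath_subset[OF p(1)] p(2) by (auto simp: q_def)
  moreover have "pcas a q b" using q by (auto simp: T.apath_def T.awalk_def)
  ultimately have "set (pawalk_verts a q) \<subseteq> K" using assms(4) by (auto simp: pawalk_verts_eq)
  with q that show thesis by (auto simp: T.apath_def)
qed

lemma undirected_tree_unique_neighbour:
  assumes T: "undirected_tree T" and K: "conn (parcs T) K" "K \<subseteq> pverts T" "x \<notin> K"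
    and ab: "a \<in> K" "b \<in> K" "(x, a) \<in> parcs T" "(x, b) \<in> parcs T"
  shows "a = b"
proof (rule ccontr)
  assume "a \<noteq> b"
  have pg: "pair_graph T" using T by (simp add: undirected_tree_def)
  interpret T: pair_graph T by fact
  obtain p where p: "T.awalk a p b" "distinct (pawalk_verts a p)" "set (pawalk_verts a p) \<subseteq> K"
    using conn_apath_inside[OF pg K(1,2) ab(1,2)] .
  have cas: "pcas a p b" using p(1) by (simp add: T.awalk_def)
  let ?c = "(x, a) # p @ [(b, x)]"
  have "(b, x) \<in> parcs T" using T.arcs_symmetric[OF ab(4)] .
  moreover have "set p \<subseteq> parcs T" using p(1) by (simp add: T.awalk_def)
  moreover have cas': "pcas x ?c x" using cas by (rule pcas_close)
  moreover have "x \<in> pverts T" using T.in_arcsD1[OF ab(3)] .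
  ultimately have "T.awalk x ?c x" unfolding T.awalk_def using ab(3) by simp
  moreover have "distinct (tl (pawalk_verts x ?c))"
    using p(2,3) K(3) pawalk_verts_eq[OF cas] pawalk_verts_eq[OF cas'] by auto
  ultimately have "T.cycle ?c" by (auto simp: T.cycle_def)
  moreover have "p \<noteq> []" using cas \<open>a \<noteq> b\<close> by auto
  then have "3 \<le> length ?c" by (cases p) auto
  ultimately show False using T unfolding undirected_tree_def by blast
qed

definition cuts_off :: "'v rel \<Rightarrow> 'v set \<Rightarrow> 'v set set \<Rightarrow> 'v set \<Rightarrow> 'v set \<Rightarrow> bool" where
  "cuts_off E V \<F> S U \<longleftrightarrow> S \<subseteq> U \<and> U \<subseteq> V \<and> \<not> adjacent E (U - S) (V - U) \<and>
     (\<exists>A\<in>\<F>. A \<subseteq> U) \<and> \<not> (\<exists>A\<in>\<F>. A \<subseteq> U - S)"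

text \<open>
  The set \<open>D\<close> below is a branch of the tree at the node \<open>x\<close>, chosen smallest among those
  whose bags cover a member of the family.
\<close>

lemma tree_decomposition_separation:
  fixes \<F> :: "'a set set"
  assumes G: "pair_graph G" and td: "tree_decomposition G T B"
    and F: "\<F> \<noteq> {}" "\<And>A. A \<in> \<F> \<Longrightarrow> conn (parcs G) A \<and> A \<subseteq> pverts G"
  obtains x U where "x \<in> pverts T" "cuts_off (parcs G) (pverts G) \<F> (B x) U"
proof -
  have T: "undirected_tree T" and pg: "pair_graph T"
    and Bs: "\<And>x. x \<in> pverts T \<Longrightarrow> B x \<subseteq> pverts G"
    and Be: "\<And>u v. (u, v) \<in> parcs G \<Longrightarrow> \<exists>x\<in>pverts T. u \<in> B x \<and> v \<in> B x"
    using td by (auto simp: tree_decomposition_def undirected_tree_def)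
  interpret T: pair_graph T by fact
  note symT = pair_graph_sym[OF pg]
  define I where "I v = {x \<in> pverts T. v \<in> B x}" for v
  have I: "conn (parcs T) (I v)" if "v \<in> pverts G" for v
    using td that connected_iff_conn[OF symT, of "I v"]
    by (auto simp: tree_decomposition_def I_def)
  have Gv: "u \<in> pverts G" "v \<in> pverts G" if "(u, v) \<in> parcs G" for u v
    using that G by (auto simp: pair_graph_def pair_pseudo_graph_def pair_sym_digraph_def
        dest: pair_wf_digraph.in_arcsD1 pair_wf_digraph.in_arcsD2)
  define cover where "cover D = (\<Union>d\<in>D. B d)" for D
  define P where "P = (\<lambda>(x, D). x \<in> D \<and> D \<subseteq> pverts T \<and>
      \<not> adjacent (parcs T) (D - {x}) (pverts T - D) \<and> (\<exists>A\<in>\<F>. A \<subseteq> cover D))"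
  have "conn (parcs T) (pverts T)"
    using T connected_iff_conn[OF symT, of "pverts T"] induce_subgraph_pverts[of T]
    by (simp add: undirected_tree_def T.pair_wf_digraph)
  then obtain x0 where x0: "x0 \<in> pverts T" by (auto simp: conn_def)
  obtain A0 where A0: "A0 \<in> \<F>" using F by blast
  have "v \<in> cover (pverts T)" if "v \<in> A0" for v
  proof -
    have "v \<in> pverts G" using that A0 F by blast
    from I[OF this] show ?thesis by (auto simp: conn_def cover_def I_def)
  qed
  then have "P (x0, pverts T)" using x0 A0 by (auto simp: P_def adjacent_def)
  then obtain x D where P: "P (x, D)" and min: "\<And>y K. P (y, K) \<Longrightarrow> card D \<le> card K"
    using ex_has_least_nat[of P "(x0, pverts T)" "\<lambda>z. card (snd z)"] by auto
  have xD: "x \<in> D" "D \<subseteq> pverts T" and exit: "\<not> adjacent (parcs T) (D - {x}) (pverts T - D)"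
    using P by (auto simp: P_def)
  have fin: "finite D" using xD T.pair_finite_verts by (auto intro: finite_subset)
  have inside: "I v \<subseteq> K"
    if "v \<in> pverts G" "I v \<inter> K \<noteq> {}" "x \<notin> I v"
      "\<not> adjacent (parcs T) (K - {x}) (pverts T - K - {x})" for v K
  proof (rule conn_subset_of_no_exit[OF I])
    show "\<not> adjacent (parcs T) (I v \<inter> K) (I v - K)"
      using that by (auto simp: adjacent_def I_def)
  qed (use that in auto)
  show thesis
  proof (rule that[of x "cover D"])
    show "x \<in> pverts T" using xD by blast
    show "cuts_off (parcs G) (pverts G) \<F> (B x) (cover D)"
      unfolding cuts_off_def
    proof (intro conjI)
      show "B x \<subseteq> cover D" "cover D \<subseteq> pverts G" "\<exists>A\<in>\<F>. A \<subseteq> cover D"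
        using xD Bs P by (auto simp: cover_def P_def)
      show "\<not> adjacent (parcs G) (cover D - B x) (pverts G - cover D)"
      proof
        assume "adjacent (parcs G) (cover D - B x) (pverts G - cover D)"
        then obtain v w where vw: "v \<in> cover D - B x" "w \<in> pverts G - cover D" "(v, w) \<in> parcs G"
          by (auto simp: adjacent_def)
        have "I v \<subseteq> D"
          by (rule inside) (use vw xD exit Gv in \<open>auto simp: cover_def I_def adjacent_def\<close>)
        moreover obtain z where "z \<in> pverts T" "v \<in> B z" "w \<in> B z" using Be vw by blast
        ultimately show False using vw by (auto simp: I_def cover_def)
      qed
      show "\<not> (\<exists>A\<in>\<F>. A \<subseteq> cover D - B x)"
      proof
        assume "\<exists>A\<in>\<F>. A \<subseteq> cover D - B x"
        then obtain A where A: "A \<in> \<F>" "A \<subseteq> cover D - B x" by blast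
        have Ac: "conn (parcs G) A" "A \<subseteq> pverts G" using F A by auto
        then obtain v0 where v0: "v0 \<in> A" by (auto simp: conn_def)
        have ID: "I v \<subseteq> D - {x}" if "v \<in> A" for v
        proof -
          have "I v \<subseteq> D"
          proof (rule inside)
            show "v \<in> pverts G" using that Ac(2) by blast
            have "v \<in> cover D - B x" using that A(2) by blast
            then show "I v \<inter> D \<noteq> {}" "x \<notin> I v" using xD(2) by (auto simp: cover_def I_def)
            show "\<not> adjacent (parcs T) (D - {x}) (pverts T - D - {x})"
              using exit by (auto simp: adjacent_def)
          qed
          then show ?thesis using that A by (auto simp: I_def)
        qed
        obtain K where K: "component (parcs T) (D - {x}) K" "I v0 \<subseteq> K"
          using component_ex[OF symT, of "D - {x}" "I v0"] fin I ID v0 Ac by blast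
        have KD: "K \<subseteq> D - {x}" "conn (parcs T) K" "\<not> adjacent (parcs T) K (D - {x} - K)"
          using K by (auto simp: component_def)
        have Kexit: "\<not> adjacent (parcs T) K (pverts T - K - {x})"
          using KD exit unfolding adjacent_def by blast
        have "{v \<in> A. I v \<subseteq> K} = A"
        proof (rule ccontr)
          assume "{v \<in> A. I v \<subseteq> K} \<noteq> A"
          then have "adjacent (parcs G) {v \<in> A. I v \<subseteq> K} (A - {v \<in> A. I v \<subseteq> K})"
            using v0 K Ac by (intro connD) auto
          then obtain v w where vw: "v \<in> A" "I v \<subseteq> K" "w \<in> A" "\<not> I w \<subseteq> K" "(v, w) \<in> parcs G"
            by (auto simp: adjacent_def)
          obtain z where "z \<in> pverts T" "v \<in> B z" "w \<in> B z" using Be vw by blast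
          then have "z \<in> I w \<inter> K" using vw by (auto simp: I_def)
          then have "I w \<subseteq> K"
            using ID[OF vw(3)] Kexit Gv(2)[OF vw(5)]
            by (intro inside) (auto simp: adjacent_def)
          then show False using vw by blast
        qed
        then have AK: "A \<subseteq> cover K"
          using I Ac by (fastforce simp: cover_def I_def conn_def)
        have "adjacent (parcs T) K (pverts T - K)"
          using KD xD \<open>conn (parcs T) (pverts T)\<close> by (intro connD) (auto simp: conn_def)
        then obtain y where y: "y \<in> K" "(y, x) \<in> parcs T"
          using Kexit by (auto simp: adjacent_def)
        have "\<not> adjacent (parcs T) (K - {y}) (pverts T - K)"
        proof
          assume "adjacent (parcs T) (K - {y}) (pverts T - K)"
          then obtain y' where y': "y' \<in> K - {y}" "(y', x) \<in> parcs T"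
            using Kexit by (auto simp: adjacent_def)
          have "y' = y"
            using undirected_tree_unique_neighbour[OF T KD(2), of x y' y] KD(1) xD y y'
              T.arcs_symmetric[OF y(2)] T.arcs_symmetric[OF y'(2)]
            by auto
          then show False using y' by blast
        qed
        then have "P (y, K)" using y KD xD AK A by (auto simp: P_def)
        then have "card D \<le> card K" by (rule min)
        moreover have "card K < card D" using KD xD fin by (intro psubset_card_mono) auto
        ultimately show False by simp
      qed
    qed
  qed
qed

section \<open>Splitting a component\<close>

definition clique_model :: "'v rel \<Rightarrow> 'v set \<Rightarrow> nat set \<Rightarrow> (nat \<Rightarrow> 'v set) \<Rightarrow> bool" where
  "clique_model E C I R \<longleftrightarrow> finite I \<and>
     (\<forall>i\<in>I. conn E (R i) \<and> R i \<inter> C = {}) \<and>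
     (\<forall>i\<in>I. \<forall>j\<in>I. i \<noteq> j \<longrightarrow> R i \<inter> R j = {} \<and> adjacent E (R i) (R j))"

locale sparse_graph =
  fixes E :: "'v rel" and V :: "'v set" and b s t :: nat
  assumes sym: "sym E" and fin: "finite V" and edges: "E \<subseteq> V \<times> V" and t: "t \<ge> 2"
    and sep: "\<And>\<F>. \<F> \<noteq> {} \<Longrightarrow> (\<And>A. A \<in> \<F> \<Longrightarrow> conn E A \<and> A \<subseteq> V) \<Longrightarrow>
      \<exists>S U. card S \<le> b \<and> cuts_off E V \<F> S U"
    and no_minor: "\<And>C I R f. clique_model E C I R \<Longrightarrow> card I = s \<Longrightarrow> conn E C \<Longrightarrow> C \<subseteq> V \<Longrightarrow>
      (\<And>i. i < t \<Longrightarrow> f i \<subseteq> C \<and> conn E (f i) \<and> (\<forall>j\<in>I. adjacent E (f i) (R j))) \<Longrightarrow>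
      disjoint_family_on f {..<t} \<Longrightarrow> (\<And>i. i \<in> I \<Longrightarrow> R i \<subseteq> V) \<Longrightarrow> False"
begin

lemma packing_or_hitting_set:
  assumes "\<And>A. A \<in> \<F> \<Longrightarrow> conn E A \<and> A \<subseteq> V"
  shows "(\<exists>f. (\<forall>i<Suc n. f i \<in> \<F>) \<and> disjoint_family_on f {..<Suc n}) \<or>
    (\<exists>S\<subseteq>V. card S \<le> n * b \<and> (\<forall>A\<in>\<F>. A \<inter> S \<noteq> {}))"
  using assms
proof (induction n arbitrary: \<F>)
  case 0
  show ?case
  proof (cases "\<F> = {}")
    case True
    then show ?thesis by (intro disjI2 exI[of _ "{}"]) auto
  next
    case False
    then obtain A where "A \<in> \<F>" by blast
    then show ?thesis by (intro disjI1 exI[of _ "\<lambda>_. A"]) (auto simp: disjoint_family_on_def)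
  qed
next
  case (Suc n)
  show ?case
  proof (cases "\<F> = {}")
    case True
    then show ?thesis by (intro disjI2 exI[of _ "{}"]) auto
  next
    case False
    then obtain S U where S0: "card S \<le> b" "cuts_off E V \<F> S U"
      using sep[OF _ Suc.prems] by blast
    then obtain A0 where S: "S \<subseteq> U" "U \<subseteq> V" "\<not> adjacent E (U - S) (V - U)"
        and A0: "A0 \<in> \<F>" "A0 \<subseteq> U" and none: "\<not> (\<exists>A\<in>\<F>. A \<subseteq> U - S)"
      by (auto simp: cuts_off_def)
    let ?F = "{A \<in> \<F>. A \<inter> U = {}}"
    have away: "A \<inter> U = {}" if A: "A \<in> \<F>" "A \<inter> S = {}" for A
    proof (rule ccontr)
      assume "A \<inter> U \<noteq> {}"
      then have "A \<inter> (U - S) \<noteq> {}" using A by blast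
      moreover have "\<not> adjacent E (A \<inter> (U - S)) (A - (U - S))"
        using S(3) A Suc.prems[OF A(1)] unfolding adjacent_def by blast
      ultimately have "A \<subseteq> U - S" using Suc.prems[OF A(1)] by (intro conn_subset_of_no_exit) auto
      then show False using none A by blast
    qed
    have "(\<exists>f. (\<forall>i<Suc n. f i \<in> ?F) \<and> disjoint_family_on f {..<Suc n}) \<or>
        (\<exists>S\<subseteq>V. card S \<le> n * b \<and> (\<forall>A\<in>?F. A \<inter> S \<noteq> {}))"
      using Suc.prems by (intro Suc.IH) auto
    then show ?thesis
    proof (elim disjE exE conjE)
      fix f assume f: "\<forall>i<Suc n. f i \<in> ?F" "disjoint_family_on f {..<Suc n}"
      let ?g = "f(Suc n := A0)"
      have "f i \<inter> A0 = {}" if "i < Suc n" for i using f(1) that A0 by blast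
      then have "disjoint_family_on ?g {..<Suc (Suc n)}"
        using f(2) unfolding lessThan_Suc[of "Suc n"] disjoint_family_on_def
        by (simp add: Int_commute)
      moreover have "?g i \<in> \<F>" if "i < Suc (Suc n)" for i
        using f(1) A0(1) that by (cases "i = Suc n") auto
      ultimately show ?thesis by blast
    next
      fix S' assume S': "S' \<subseteq> V" "card S' \<le> n * b" "\<forall>A\<in>?F. A \<inter> S' \<noteq> {}"
      have "card (S \<union> S') \<le> Suc n * b" using card_Un_le[of S S'] S0 S' by simp
      moreover have "A \<inter> (S \<union> S') \<noteq> {}" if "A \<in> \<F>" for A
      proof (cases "A \<inter> S = {}")
        case True
        then have "A \<in> ?F" using away that by simp
        then show ?thesis using S'(3) by blast
      qed blast
      moreover have "S \<union> S' \<subseteq> V" using S S' by blast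
      ultimately show ?thesis by blast
    qed
  qed
qed

text \<open>
  The two ways in which a component \<open>K\<close> of \<open>C - S\<close> inherits a clique model: either \<open>S\<close> is absorbed
  into a new branch set, or into an old one that \<open>K\<close> does not see.
\<close>

definition splits :: "'v set \<Rightarrow> nat set \<Rightarrow> (nat \<Rightarrow> 'v set) \<Rightarrow> 'v set \<Rightarrow> bool" where
  "splits C I R S \<longleftrightarrow> (\<forall>K. component E (C - S) K \<longrightarrow>
     (card I < s \<and> (\<exists>D. D \<subseteq> C - K \<and> conn E D \<and> S \<subseteq> D \<and> (\<forall>i\<in>I. adjacent E D (R i)))) \<or>
     (\<exists>i\<in>I. \<not> adjacent E K (R i) \<and> (\<exists>Q. Q \<subseteq> C - K \<and> S \<subseteq> Q \<and> conn E (R i \<union> Q))))"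

lemma absorb_into_old_branch_set:
  assumes C: "C \<subseteq> V" and S: "S \<subseteq> C" and K: "component E (C - S) K"
    and R: "conn E R" "\<not> adjacent E K R"
    and A: "\<And>v. v \<in> S \<Longrightarrow> \<exists>A. conn E A \<and> A \<subseteq> C \<and> A \<inter> S = {v} \<and> adjacent E A R"
  shows "\<exists>Q. Q \<subseteq> C - K \<and> S \<subseteq> Q \<and> conn E (R \<union> Q)"
proof -
  obtain A where A: "\<And>v. v \<in> S \<Longrightarrow> conn E (A v) \<and> A v \<subseteq> C \<and> A v \<inter> S = {v} \<and> adjacent E (A v) R"
    using A by metis
  have "finite S" using C S fin by (meson finite_subset)
  then have "conn E (R \<union> (\<Union>v\<in>S. A v - K))"
  proof (rule conn_Un_UN[OF sym _ R(1)])
    fix v assume v: "v \<in> S"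
    show "conn E (A v - K)" using A[OF v] by (intro conn_minus_component[OF sym K]) auto
    show "adjacent E (A v - K) R" using A[OF v] R(2) by (auto simp: adjacent_def)
  qed
  moreover have "v \<in> A v - K" if "v \<in> S" for v
    using A[OF that] K that by (auto simp: component_def)
  moreover have "(\<Union>v\<in>S. A v - K) \<subseteq> C - K" using A by blast
  ultimately show ?thesis by (intro exI[of _ "\<Union>v\<in>S. A v - K"]) blast
qed

lemma split_full_clique:
  assumes model: "clique_model E C I R" "\<And>i. i \<in> I \<Longrightarrow> R i \<subseteq> V" and I: "card I = s"
    and C: "conn E C" "C \<subseteq> V" and adj: "\<And>i. i \<in> I \<Longrightarrow> adjacent E C (R i)"
  shows "\<exists>S\<subseteq>C. S \<noteq> {} \<and> card S \<le> (t - 1) * b \<and> splits C I R S"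
proof -
  define \<F> where "\<F> = {A. A \<subseteq> C \<and> conn E A \<and> (\<forall>i\<in>I. adjacent E A (R i))}"
  have members: "conn E A \<and> A \<subseteq> V" if "A \<in> \<F>" for A using that C by (auto simp: \<F>_def)
  have "\<not> (\<exists>f. (\<forall>i<Suc (t - 1). f i \<in> \<F>) \<and> disjoint_family_on f {..<Suc (t - 1)})"
  proof
    assume "\<exists>f. (\<forall>i<Suc (t - 1). f i \<in> \<F>) \<and> disjoint_family_on f {..<Suc (t - 1)}"
    then obtain f where "\<forall>i<t. f i \<in> \<F>" "disjoint_family_on f {..<t}" using t by auto
    then show False
      using no_minor[OF model(1) I C, of f] model(2) by (auto simp: \<F>_def)
  qed
  then obtain S0 where S0: "S0 \<subseteq> V" "card S0 \<le> (t - 1) * b" "\<forall>A\<in>\<F>. A \<inter> S0 \<noteq> {}"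
    using packing_or_hitting_set[of \<F> "t - 1"] members by metis
  define P where "P S \<longleftrightarrow> S \<subseteq> C \<and> (\<forall>A\<in>\<F>. A \<inter> S \<noteq> {})" for S
  have "A \<inter> (S0 \<inter> C) \<noteq> {}" if "A \<in> \<F>" for A
  proof -
    have "A \<subseteq> C" using that by (simp add: \<F>_def)
    then show ?thesis using S0(3) that by blast
  qed
  then have "P (S0 \<inter> C)" by (simp add: P_def)
  then obtain S where S: "P S" and min: "\<And>S'. P S' \<Longrightarrow> card S \<le> card S'"
    using ex_has_least_nat[of P "S0 \<inter> C" card] by blast
  have SC: "S \<subseteq> C" and hit: "\<And>A. A \<in> \<F> \<Longrightarrow> A \<inter> S \<noteq> {}" using S by (auto simp: P_def)
  have finS: "finite S" using SC C fin by (meson finite_subset)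
  have "card (S0 \<inter> C) \<le> card S0" using S0 fin by (meson card_mono finite_subset inf_le1)
  then have "card S \<le> (t - 1) * b" using min[OF \<open>P (S0 \<inter> C)\<close>] S0 by simp
  moreover have "C \<in> \<F>" using C adj by (auto simp: \<F>_def)
  then have "S \<noteq> {}" using hit by blast
  moreover have "splits C I R S"
    unfolding splits_def
  proof (intro allI impI disjI2)
    fix K assume K: "component E (C - S) K"
    then have "K \<subseteq> C" "conn E K" "K \<inter> S = {}" by (auto simp: component_def)
    then obtain i where i: "i \<in> I" "\<not> adjacent E K (R i)" using hit[of K] by (auto simp: \<F>_def)
    have "\<exists>A. conn E A \<and> A \<subseteq> C \<and> A \<inter> S = {v} \<and> adjacent E A (R i)" if v: "v \<in> S" for v
    proof -
      have "card (S - {v}) < card S" using v finS by (intro psubset_card_mono) auto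
      then have "\<not> P (S - {v})" using min[of "S - {v}"] by auto
      then obtain A where A: "A \<in> \<F>" "A \<inter> (S - {v}) = {}" using SC by (auto simp: P_def)
      then have "A \<inter> S \<subseteq> {v}" by blast
      then have "A \<inter> S = {v}" using hit[OF A(1)] by blast
      then show ?thesis using A(1) i(1) by (auto simp: \<F>_def)
    qed
    then have "\<exists>Q. Q \<subseteq> C - K \<and> S \<subseteq> Q \<and> conn E (R i \<union> Q)"
      using model i by (intro absorb_into_old_branch_set[OF C(2) SC K]) (auto simp: clique_model_def)
    then show "\<exists>i\<in>I. \<not> adjacent E K (R i) \<and> (\<exists>Q. Q \<subseteq> C - K \<and> S \<subseteq> Q \<and> conn E (R i \<union> Q))"
      using i by blast
  qed
  ultimately show ?thesis using SC by blast
qed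

text \<open>
  Minimality of \<open>S\<close> and then maximality of \<open>D\<close> give every vertex of \<open>S\<close> a way out to each branch
  set that avoids the components of \<open>D - S\<close>; the components outside \<open>D\<close> use \<open>D\<close> as new branch set.
\<close>

lemma split_small_clique:
  assumes model: "clique_model E C I R" and I: "card I < s"
    and C: "conn E C" "C \<subseteq> V" and adj: "\<And>i. i \<in> I \<Longrightarrow> adjacent E C (R i)"
  shows "\<exists>S\<subseteq>C. S \<noteq> {} \<and> card S \<le> b \<and> splits C I R S"
proof -
  have finC: "finite C" using C fin by (meson finite_subset)
  define \<F> where "\<F> = {A. A \<subseteq> C \<and> conn E A \<and> (\<forall>i\<in>I. adjacent E A (R i))}"
  define P where "P S D \<longleftrightarrow> S \<subseteq> D \<and> D \<in> \<F> \<and> \<not> adjacent E (D - S) (C - D) \<and>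
    \<not> (\<exists>A\<in>\<F>. A \<subseteq> D - S)" for S D
  have members: "conn E A \<and> A \<subseteq> V" if "A \<in> \<F>" for A using that C by (auto simp: \<F>_def)
  have "\<F> \<noteq> {}" using C adj by (auto simp: \<F>_def)
  then obtain S1 U where S1: "card S1 \<le> b" "cuts_off E V \<F> S1 U"
    using sep[OF _ members] by blast
  then obtain A0 where U: "S1 \<subseteq> U" "U \<subseteq> V" "\<not> adjacent E (U - S1) (V - U)"
      and A0: "A0 \<in> \<F>" "A0 \<subseteq> U" and none: "\<not> (\<exists>A\<in>\<F>. A \<subseteq> U - S1)"
    by (auto simp: cuts_off_def)
  have A0c: "conn E A0" "A0 \<subseteq> U \<inter> C" using A0 by (auto simp: \<F>_def)
  obtain D0 where D0: "component E (U \<inter> C) D0" "A0 \<subseteq> D0"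
    using component_ex[OF sym _ A0c] finC by blast
  then have D0': "D0 \<subseteq> U \<inter> C" "conn E D0" "\<not> adjacent E D0 (U \<inter> C - D0)"
    by (auto simp: component_def)
  have "P (S1 \<inter> D0) D0"
    unfolding P_def
  proof (intro conjI)
    have "adjacent E D0 (R i)" if "i \<in> I" for i
    proof (rule adjacent_mono)
      show "adjacent E A0 (R i)" using A0(1) that by (simp add: \<F>_def)
    qed (use D0 in auto)
    then show "D0 \<in> \<F>" using D0' by (auto simp: \<F>_def)
    show "\<not> adjacent E (D0 - S1 \<inter> D0) (C - D0)"
    proof
      assume "adjacent E (D0 - S1 \<inter> D0) (C - D0)"
      then obtain v w where vw: "v \<in> D0" "v \<notin> S1" "w \<in> C" "w \<notin> D0" "(v, w) \<in> E"
        by (auto simp: adjacent_def)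
      have "w \<in> U"
      proof (rule ccontr)
        assume "w \<notin> U"
        then have "v \<in> U - S1" "w \<in> V - U" using vw D0'(1) C(2) by auto
        then have "adjacent E (U - S1) (V - U)" using vw(5) by (auto simp: adjacent_def)
        then show False using U by blast
      qed
      then have "adjacent E D0 (U \<inter> C - D0)" using vw by (auto simp: adjacent_def)
      then show False using D0' by blast
    qed
    show "\<not> (\<exists>A\<in>\<F>. A \<subseteq> D0 - S1 \<inter> D0)"
    proof
      assume "\<exists>A\<in>\<F>. A \<subseteq> D0 - S1 \<inter> D0"
      then obtain A where "A \<in> \<F>" "A \<subseteq> D0 - S1" by blast
      moreover then have "A \<subseteq> U - S1" using D0' by blast
      ultimately show False using none by blast
    qed
  qed simp
  then obtain S where "\<exists>D. P S D" and minS: "\<And>S'. \<exists>D. P S' D \<Longrightarrow> card S \<le> card S'"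
    using ex_has_least_nat[of "\<lambda>S. \<exists>D. P S D" "S1 \<inter> D0" card] by blast
  moreover have "card D < Suc (card C)" if "P S D" for D
    using that finC by (auto simp: P_def \<F>_def less_Suc_eq_le intro: card_mono)
  ultimately obtain D where PD: "P S D" and maxD: "\<And>D'. P S D' \<Longrightarrow> card D' \<le> card D"
    using ex_has_greatest_nat[of "P S" _ card "Suc (card C)"] by blast
  have SD: "S \<subseteq> D" and DF: "D \<in> \<F>" and exit: "\<not> adjacent E (D - S) (C - D)"
    and noF: "\<not> (\<exists>A\<in>\<F>. A \<subseteq> D - S)"
    using PD by (auto simp: P_def)
  have DC: "D \<subseteq> C" "conn E D" using DF by (auto simp: \<F>_def)
  have SC: "S \<subseteq> C" using SD DC by blast
  have finS: "finite S" using SC finC by (meson finite_subset)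
  have "finite S1" using U fin by (meson finite_subset)
  then have "card (S1 \<inter> D0) \<le> card S1" by (intro card_mono) auto
  then have "card S \<le> b" using minS[of "S1 \<inter> D0"] \<open>P (S1 \<inter> D0) D0\<close> S1(1) by fastforce
  moreover have "S \<noteq> {}"
  proof
    assume "S = {}"
    then show False using noF DF by auto
  qed
  moreover have way_out: "\<exists>A. conn E A \<and> A \<subseteq> C \<and> A \<inter> S = {v} \<and> adjacent E A (R i)"
    if v: "v \<in> S" and i: "i \<in> I" for v i
  proof -
    have "card (S - {v}) < card S" using v finS by (intro psubset_card_mono) auto
    then have "\<not> P (S - {v}) D" using minS[of "S - {v}"] by auto
    then consider (member) A where "A \<in> \<F>" "A \<subseteq> D - (S - {v})"
      | (exit) "adjacent E (D - (S - {v})) (C - D)"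
      using SD DF unfolding P_def by blast
    then show ?thesis
    proof cases
      case member
      then have "v \<in> A" using noF by blast
      then have "A \<inter> S = {v}" using member(2) v by auto
      then show ?thesis using member i by (auto simp: \<F>_def)
    next
      case exit': exit
      then obtain z where z: "z \<in> C - D" "(v, z) \<in> E" using exit by (auto simp: adjacent_def)
      obtain K where K: "component E (C - D) K" "{z} \<subseteq> K"
        using component_ex[OF sym _ conn_singleton, of "C - D" z] z finC by blast
      then have K': "K \<subseteq> C - D" "conn E K" "\<not> adjacent E K (C - D - K)"
        by (auto simp: component_def)
      have "K \<in> \<F>"
      proof (rule ccontr)
        assume KF: "K \<notin> \<F>"
        have "v \<in> D" "z \<in> K" using v SD K(2) by auto
        then have "adjacent E D K" using z(2) by (auto simp: adjacent_def)
        then have "conn E (D \<union> K)" using DC K' by (intro conn_Un[OF sym]) auto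
        then have 1: "D \<union> K \<in> \<F>" using DF K'(1) unfolding \<F>_def adjacent_def by blast
        have 2: "\<not> adjacent E (D \<union> K - S) (C - (D \<union> K))"
          using exit K' unfolding adjacent_def by blast
        have 3: "\<not> (\<exists>A\<in>\<F>. A \<subseteq> D \<union> K - S)"
        proof
          assume "\<exists>A\<in>\<F>. A \<subseteq> D \<union> K - S"
          then obtain A where A: "A \<in> \<F>" "A \<subseteq> D \<union> K - S" by blast
          have Ac: "conn E A" using A by (simp add: \<F>_def)
          have "A \<subseteq> K"
          proof (cases "A \<inter> (D - S) = {}")
            case True
            then show ?thesis using A by blast
          next
            case False
            have "\<not> adjacent E (A \<inter> (D - S)) (A - (D - S))"
              using exit A K' unfolding adjacent_def by blast
            then have "A \<subseteq> D - S" using conn_subset_of_no_exit[OF Ac False] by blast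
            then show ?thesis using noF A by blast
          qed
          moreover have "adjacent E K (R j)" if "j \<in> I" for j
            using A(1) that adjacent_mono[of E A "R j" K "R j"] \<open>A \<subseteq> K\<close> by (simp add: \<F>_def)
          ultimately show False using KF K' by (auto simp: \<F>_def)
        qed
        have "P S (D \<union> K)" unfolding P_def using 1 2 3 SD by blast
        then have "card (D \<union> K) \<le> card D" by (rule maxD)
        moreover have "card D < card (D \<union> K)"
          using K K' DC finC by (intro psubset_card_mono) (auto intro: finite_subset)
        ultimately show False by simp
      qed
      then have "adjacent E K (R i)" using i by (simp add: \<F>_def)
      then have "adjacent E (insert v K) (R i)" by (rule adjacent_mono) auto
      moreover have "conn E (insert v K)"
        using conn_insert[OF sym K'(2), of z v] z K symD[OF sym] by blast
      moreover have "insert v K \<subseteq> C" "insert v K \<inter> S = {v}" using K' v SC SD by auto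
      ultimately show ?thesis by blast
    qed
  qed
  have "splits C I R S"
    unfolding splits_def
  proof (intro allI impI)
    fix K assume K: "component E (C - S) K"
    then have K': "K \<subseteq> C" "conn E K" "K \<inter> S = {}" by (auto simp: component_def)
    show "card I < s \<and> (\<exists>D. D \<subseteq> C - K \<and> conn E D \<and> S \<subseteq> D \<and> (\<forall>i\<in>I. adjacent E D (R i))) \<or>
     (\<exists>i\<in>I. \<not> adjacent E K (R i) \<and> (\<exists>Q. Q \<subseteq> C - K \<and> S \<subseteq> Q \<and> conn E (R i \<union> Q)))"
    proof (cases "K \<inter> D = {}")
      case True
      then show ?thesis using I DF SD by (intro disjI1) (auto simp: \<F>_def)
    next
      case False
      have "\<not> adjacent E (K \<inter> (D - S)) (K - (D - S))"
        using exit K' unfolding adjacent_def by blast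
      moreover have "K \<inter> (D - S) \<noteq> {}" using False K' by blast
      ultimately have "K \<subseteq> D - S" using K' by (intro conn_subset_of_no_exit) auto
      then have "K \<notin> \<F>" using noF by blast
      then obtain i where i: "i \<in> I" "\<not> adjacent E K (R i)" using K' by (auto simp: \<F>_def)
      have "\<exists>Q. Q \<subseteq> C - K \<and> S \<subseteq> Q \<and> conn E (R i \<union> Q)"
        using model i way_out
        by (intro absorb_into_old_branch_set[OF C(2) SC K]) (auto simp: clique_model_def)
      then show ?thesis using i by blast
    qed
  qed
  ultimately show ?thesis using SC by blast
qed

end

section \<open>The partition\<close>

text \<open>
  The parts are numbered in the order of their creation; \<open>N j\<close> is the set of the earlier parts that
  part \<open>j\<close> is joined to.
\<close>

definition clique_order :: "nat \<Rightarrow> nat \<Rightarrow> (nat \<Rightarrow> nat set) \<Rightarrow> bool" where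
  "clique_order s n N \<longleftrightarrow> (\<forall>j<n. N j \<subseteq> {..<j} \<and> card (N j) \<le> s \<and>
     (\<forall>a\<in>N j. \<forall>c\<in>N j. a < c \<longrightarrow> a \<in> N c))"

context sparse_graph
begin

definition attached :: "nat \<Rightarrow> ('v \<Rightarrow> nat) \<Rightarrow> (nat \<Rightarrow> nat set) \<Rightarrow> 'v set \<Rightarrow> nat set \<Rightarrow>
    (nat \<Rightarrow> 'v set) \<Rightarrow> bool" where
  "attached n p N C I R \<longleftrightarrow> clique_model E C I R \<and> (\<forall>i\<in>I. R i \<subseteq> V) \<and> card I \<le> s \<and> I \<subseteq> {..<n} \<and>
     (\<forall>a\<in>I. \<forall>c\<in>I. a < c \<longrightarrow> a \<in> N c) \<and>
     (\<forall>c\<in>C. \<forall>w. (c, w) \<in> E \<and> w \<notin> C \<longrightarrow> p w \<in> I \<and> w \<in> R (p w))"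

lemma attachedI:
  assumes "clique_model E C I R" "card I \<le> s" "I \<subseteq> {..<n}" "\<And>i. i \<in> I \<Longrightarrow> R i \<subseteq> V"
    "\<And>a c. a \<in> I \<Longrightarrow> c \<in> I \<Longrightarrow> a < c \<Longrightarrow> a \<in> N c"
    "\<And>c w. c \<in> C \<Longrightarrow> (c, w) \<in> E \<Longrightarrow> w \<notin> C \<Longrightarrow> p w \<in> I \<and> w \<in> R (p w)"
  shows "attached n p N C I R"
  using assms unfolding attached_def by simp

text \<open>\<open>X\<close> is the set of the vertices that have not been assigned to a part yet.\<close>

definition partial_partition :: "'v set \<Rightarrow> nat \<Rightarrow> ('v \<Rightarrow> nat) \<Rightarrow> (nat \<Rightarrow> nat set) \<Rightarrow> bool" where
  "partial_partition X n p N \<longleftrightarrow> X \<subseteq> V \<and> 0 < n \<and> clique_order s n N \<and>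
     (\<forall>v\<in>V - X. p v < n) \<and> (\<forall>i<n. card {v \<in> V - X. p v = i} \<le> (t - 1) * b) \<and>
     (\<forall>u\<in>V - X. \<forall>v\<in>V - X. (u, v) \<in> E \<longrightarrow> p u = p v \<or> p u \<in> N (p v) \<or> p v \<in> N (p u)) \<and>
     (\<forall>C. component E X C \<longrightarrow> (\<exists>I R. attached n p N C I R))"

lemma attached_restrict:
  assumes "attached n p N C I R"
  shows "attached n p N C {i \<in> I. adjacent E C (R i)} R"
proof -
  let ?J = "{i \<in> I. adjacent E C (R i)}"
  have model: "clique_model E C I R" and I: "\<forall>i\<in>I. R i \<subseteq> V" "card I \<le> s" "I \<subseteq> {..<n}"
      "\<forall>a\<in>I. \<forall>c\<in>I. a < c \<longrightarrow> a \<in> N c"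
    and nb: "\<And>c w. c \<in> C \<Longrightarrow> (c, w) \<in> E \<Longrightarrow> w \<notin> C \<Longrightarrow> p w \<in> I \<and> w \<in> R (p w)"
    using assms unfolding attached_def by blast+
  have "finite I" using model by (simp add: clique_model_def)
  then have "card ?J \<le> s" using I(2) card_mono[of I ?J] by simp
  moreover have "clique_model E C ?J R" using model unfolding clique_model_def by simp
  moreover have "p w \<in> ?J \<and> w \<in> R (p w)" if "c \<in> C" "(c, w) \<in> E" "w \<notin> C" for c w
  proof -
    have "p w \<in> I" "w \<in> R (p w)" using nb[OF that] by auto
    moreover then have "adjacent E C (R (p w))" using that unfolding adjacent_def by blast
    ultimately show ?thesis by blast
  qed
  ultimately show ?thesis using I unfolding attached_def by blast
qed

lemma split_attached:
  assumes att: "attached n p N C I R" and adj: "\<And>i. i \<in> I \<Longrightarrow> adjacent E C (R i)"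
    and C: "conn E C" "C \<subseteq> V"
  shows "\<exists>S\<subseteq>C. S \<noteq> {} \<and> card S \<le> (t - 1) * b \<and> splits C I R S"
proof -
  have model: "clique_model E C I R" using att by (simp add: attached_def)
  show ?thesis
  proof (cases "card I = s")
    case True
    have "\<And>i. i \<in> I \<Longrightarrow> R i \<subseteq> V" using att by (simp add: attached_def)
    then show ?thesis using split_full_clique[OF model _ True C adj] by blast
  next
    case False
    then have "card I < s" using att by (simp add: attached_def)
    then obtain S where S: "S \<subseteq> C" "S \<noteq> {}" "card S \<le> b" "splits C I R S"
      using split_small_clique[OF model _ C adj] by blast
    have "1 * b \<le> (t - 1) * b" by (rule mult_le_mono1) (use t in linarith)
    then have "card S \<le> (t - 1) * b" using S(3) by linarith
    then show ?thesis using S by (intro exI[of _ S]) simp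
  qed
qed

lemma attached_of_splits:
  assumes att: "attached n p N C I R" and C: "C \<subseteq> V" and S: "S \<subseteq> C" "splits C I R S"
    and K: "component E (C - S) K"
  shows "\<exists>I' R'. attached (Suc n) (\<lambda>v. if v \<in> S then n else p v) (N(n := I)) K I' R'"
proof -
  have model: "finite I" "\<And>i. i \<in> I \<Longrightarrow> conn E (R i)" "\<And>i. i \<in> I \<Longrightarrow> R i \<inter> C = {}"
      "\<And>i j. i \<in> I \<Longrightarrow> j \<in> I \<Longrightarrow> i \<noteq> j \<Longrightarrow> R i \<inter> R j = {}"
      "\<And>i j. i \<in> I \<Longrightarrow> j \<in> I \<Longrightarrow> i \<noteq> j \<Longrightarrow> adjacent E (R i) (R j)"
    and RV: "\<And>i. i \<in> I \<Longrightarrow> R i \<subseteq> V" and I: "card I \<le> s" "\<And>i. i \<in> I \<Longrightarrow> i < n"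
      "\<And>a c. a \<in> I \<Longrightarrow> c \<in> I \<Longrightarrow> a < c \<Longrightarrow> a \<in> N c"
    and nb: "\<And>c w. c \<in> C \<Longrightarrow> (c, w) \<in> E \<Longrightarrow> w \<notin> C \<Longrightarrow> p w \<in> I \<and> w \<in> R (p w)"
    using att by (auto simp: attached_def clique_model_def)
  have K': "K \<subseteq> C - S" "\<not> adjacent E K (C - S - K)" using K by (auto simp: component_def)
  have nK: "w \<in> S \<or> w \<notin> C \<and> p w \<in> I \<and> w \<in> R (p w)" if "c \<in> K" "(c, w) \<in> E" "w \<notin> K" for c w
    using that K' nb[of c w] by (auto simp: adjacent_def)
  have clique: "a \<in> (N(n := I)) c" if "a \<in> insert n I" "c \<in> insert n I" "a < c" for a c
    using that I(2)[of a] I(2)[of c] I(3)[of a c] by (cases "c = n") auto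
  have new: "attached (Suc n) (\<lambda>v. if v \<in> S then n else p v) (N(n := I)) K (insert n J) (R(n := D))"
    if J: "J \<subseteq> I" "card J < s" and D: "D \<subseteq> V" "D \<inter> K = {}" "conn E D" "S \<subseteq> D"
      and DJ: "\<And>j. j \<in> J \<Longrightarrow> R j \<inter> D = {}" "\<And>j. j \<in> J \<Longrightarrow> adjacent E D (R j)"
      and drop: "\<And>i. i \<in> I - J \<Longrightarrow> \<not> adjacent E K (R i)" for J D
  proof -
    have n: "n \<notin> J" using J I(2) by auto
    have finJ: "finite J" using J model(1) by (meson finite_subset)
    have Rn: "(R(n := D)) j = R j" if "j \<in> J" for j using that n by auto
    have m1: "conn E ((R(n := D)) i) \<and> (R(n := D)) i \<inter> K = {}" if "i \<in> insert n J" for i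
    proof (cases "i = n")
      case True
      then show ?thesis using D by simp
    next
      case False
      then have i: "i \<in> I" "(R(n := D)) i = R i" using that J by auto
      then have "R i \<inter> K = {}" using model(3)[OF i(1)] K'(1) by blast
      then show ?thesis using model(2)[OF i(1)] i(2) by simp
    qed
    have m2: "(R(n := D)) i \<inter> (R(n := D)) j = {} \<and> adjacent E ((R(n := D)) i) ((R(n := D)) j)"
      if ij: "i \<in> insert n J" "j \<in> insert n J" "i \<noteq> j" for i j
    proof -
      consider "i = n" "j \<in> J" | "j = n" "i \<in> J" | "i \<in> J" "j \<in> J" using ij by blast
      then show ?thesis
      proof cases
        case 1
        then show ?thesis using DJ[OF 1(2)] Rn[OF 1(2)] by (simp add: Int_commute)
      next
        case 2
        then show ?thesis
          using DJ(1)[OF 2(2)] adjacent_sym[OF sym DJ(2)[OF 2(2)]] Rn[OF 2(2)] by simp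
      next
        case 3
        then have "i \<in> I" "j \<in> I" using J by auto
        then show ?thesis using model(4,5)[OF _ _ ij(3)] Rn[OF 3(1)] Rn[OF 3(2)] by simp
      qed
    qed
    have "clique_model E K (insert n J) (R(n := D))"
      unfolding clique_model_def using finJ m1 m2 by blast
    moreover have "card (insert n J) \<le> s" using J finJ n by simp
    moreover have "insert n J \<subseteq> {..<Suc n}" using J I(2) less_SucI by blast
    moreover have "(R(n := D)) i \<subseteq> V" if "i \<in> insert n J" for i
      using that D(1) J(1) RV[of i] by (cases "i = n") auto
    moreover have "a \<in> (N(n := I)) c" if "a \<in> insert n J" "c \<in> insert n J" "a < c" for a c
      using that J by (intro clique) auto
    moreover have "(if w \<in> S then n else p w) \<in> insert n J \<and>
        w \<in> (R(n := D)) (if w \<in> S then n else p w)" if "c \<in> K" "(c, w) \<in> E" "w \<notin> K" for c w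
    proof (cases "w \<in> S")
      case True
      then show ?thesis using D by auto
    next
      case False
      then have w: "p w \<in> I" "w \<in> R (p w)" using nK[OF that] by auto
      then have "adjacent E K (R (p w))" using that by (auto simp: adjacent_def)
      then have "p w \<in> J" using drop w by blast
      then show ?thesis using w Rn False by simp
    qed
    ultimately show ?thesis by (rule attachedI)
  qed
  show ?thesis
    using S(2)[unfolded splits_def, rule_format, OF K]
  proof (elim disjE conjE exE bexE)
    fix D assume "card I < s" and D: "D \<subseteq> C - K" "conn E D" "S \<subseteq> D" "\<forall>i\<in>I. adjacent E D (R i)"
    moreover have "R j \<inter> D = {}" if "j \<in> I" for j using model(3)[OF that] D(1) by blast
    moreover have "D \<subseteq> V" "D \<inter> K = {}" using D(1) C by auto
    ultimately have "attached (Suc n) (\<lambda>v. if v \<in> S then n else p v) (N(n := I)) K (insert n I) (R(n := D))"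
      by (intro new) simp_all
    then show ?thesis by (intro exI)
  next
    fix i Q assume i: "i \<in> I" "\<not> adjacent E K (R i)" and Q: "Q \<subseteq> C - K" "S \<subseteq> Q" "conn E (R i \<union> Q)"
    have "attached (Suc n) (\<lambda>v. if v \<in> S then n else p v) (N(n := I)) K (insert n (I - {i}))
        (R(n := R i \<union> Q))"
    proof (rule new)
      have "card (I - {i}) < card I" using i model(1) by (intro psubset_card_mono) auto
      then show "card (I - {i}) < s" using I(1) by simp
      show "R i \<union> Q \<subseteq> V" using RV[OF i(1)] Q(1) C by blast
      show "(R i \<union> Q) \<inter> K = {}" using model(3)[OF i(1)] Q(1) K'(1) by blast
      show "R j \<inter> (R i \<union> Q) = {}" if "j \<in> I - {i}" for j
      proof -
        have "R j \<inter> R i = {}" "R j \<inter> C = {}" using model(3,4) that i(1) by auto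
        then show ?thesis using Q(1) by blast
      qed
      show "adjacent E (R i \<union> Q) (R j)" if "j \<in> I - {i}" for j
      proof (rule adjacent_mono)
        show "adjacent E (R i) (R j)" using model(5) that i(1) by auto
      qed auto
      show "S \<subseteq> R i \<union> Q" using Q(2) by blast
      show "\<not> adjacent E K (R j)" if "j \<in> I - (I - {i})" for j using that i by auto
    qed (use Q in auto)
    then show ?thesis by (intro exI)
  qed
qed

lemma partial_partition_step:
  assumes pp: "partial_partition X n p N" and "X \<noteq> {}"
  shows "\<exists>S p' N'. S \<subseteq> X \<and> S \<noteq> {} \<and> partial_partition (X - S) (Suc n) p' N'"
proof -
  have X: "X \<subseteq> V" and co: "clique_order s n N" and pn: "\<And>v. v \<in> V - X \<Longrightarrow> p v < n"
    and size: "\<And>i. i < n \<Longrightarrow> card {v \<in> V - X. p v = i} \<le> (t - 1) * b"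
    and edge: "\<And>u v. u \<in> V - X \<Longrightarrow> v \<in> V - X \<Longrightarrow> (u, v) \<in> E \<Longrightarrow>
        p u = p v \<or> p u \<in> N (p v) \<or> p v \<in> N (p u)"
    and att: "\<And>C. component E X C \<Longrightarrow> \<exists>I R. attached n p N C I R"
    using pp by (auto simp: partial_partition_def)
  have finX: "finite X" using X fin by (meson finite_subset)
  obtain x where "x \<in> X" using assms by blast
  then obtain C where C: "component E X C"
    using component_ex[OF sym finX conn_singleton[of E x]] by blast
  have C': "C \<subseteq> X" "conn E C" "\<not> adjacent E C (X - C)" using C by (auto simp: component_def)
  have CV: "C \<subseteq> V" using C' X by blast
  obtain I0 R where "attached n p N C I0 R" using att[OF C] by blast
  define I where "I = {i \<in> I0. adjacent E C (R i)}"
  have attC: "attached n p N C I R"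
    unfolding I_def by (rule attached_restrict) fact
  obtain S where S: "S \<subseteq> C" "S \<noteq> {}" "card S \<le> (t - 1) * b" "splits C I R S"
    using split_attached[OF attC _ C'(2) CV] by (auto simp: I_def)
  define p' where "p' = (\<lambda>v. if v \<in> S then n else p v)"
  define N' where "N' = N(n := I)"
  have I: "card I \<le> s" "I \<subseteq> {..<n}" "\<forall>a\<in>I. \<forall>c\<in>I. a < c \<longrightarrow> a \<in> N c"
    and nb: "\<And>c w. c \<in> C \<Longrightarrow> (c, w) \<in> E \<Longrightarrow> w \<notin> C \<Longrightarrow> p w \<in> I"
    using attC by (auto simp: attached_def)
  have Nlt: "N j \<subseteq> {..<j}" if "j < n" for j using co that by (auto simp: clique_order_def)
  have old: "V - (X - S) = (V - X) \<union> S" using S C' X by blast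
  have S_new: "v \<notin> S" if "v \<in> V - X" for v using that S C' by blast
  have "clique_order s (Suc n) N'"
    unfolding clique_order_def
  proof (intro allI impI)
    fix j assume j: "j < Suc n"
    show "N' j \<subseteq> {..<j} \<and> card (N' j) \<le> s \<and> (\<forall>a\<in>N' j. \<forall>c\<in>N' j. a < c \<longrightarrow> a \<in> N' c)"
    proof (cases "j = n")
      case True
      then show ?thesis using I by (auto simp: N'_def)
    next
      case False
      then have jn: "j < n" using j by simp
      then have "c \<noteq> n" if "c \<in> N j" for c using Nlt[OF jn] that by auto
      then show ?thesis using jn False co by (auto simp: N'_def clique_order_def)
    qed
  qed
  moreover have "p' v < Suc n" if "v \<in> V - (X - S)" for v
    using that pn[of v] unfolding old by (auto simp: p'_def less_Suc_eq)
  moreover have "card {v \<in> V - (X - S). p' v = i} \<le> (t - 1) * b" if "i < Suc n" for i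
  proof (cases "i = n")
    case True
    have "{v \<in> V - (X - S). p' v = i} = S"
      unfolding old True using pn S_new by (force simp: p'_def)
    then show ?thesis using S by simp
  next
    case False
    then have "{v \<in> V - (X - S). p' v = i} = {v \<in> V - X. p v = i}"
      unfolding old using S_new by (auto simp: p'_def)
    then show ?thesis using size that False by simp
  qed
  moreover have "p' u = p' v \<or> p' u \<in> N' (p' v) \<or> p' v \<in> N' (p' u)"
    if uv: "u \<in> V - (X - S)" "v \<in> V - (X - S)" "(u, v) \<in> E" for u v
  proof -
    have *: "p w \<in> I" if "c \<in> S" "w \<in> V - X" "(c, w) \<in> E" for c w
      using that S(1) C'(1) by (intro nb[of c w]) auto
    consider "u \<in> S" "v \<in> S" | "u \<in> S" "v \<in> V - X" | "u \<in> V - X" "v \<in> S" | "u \<in> V - X" "v \<in> V - X"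
      using uv unfolding old by blast
    then show ?thesis
    proof cases
      case 1
      then show ?thesis by (simp add: p'_def)
    next
      case 2
      then show ?thesis using *[OF 2 uv(3)] S_new[of v] by (simp add: p'_def N'_def)
    next
      case 3
      then show ?thesis using *[OF 3(2,1) symD[OF sym uv(3)]] S_new[of u]
        by (simp add: p'_def N'_def)
    next
      case 4
      then show ?thesis
        using edge[OF 4 uv(3)] S_new[of u] S_new[of v] pn[of u] pn[of v]
        by (simp add: p'_def N'_def)
    qed
  qed
  moreover have "\<exists>I R. attached (Suc n) p' N' K I R" if K: "component E (X - S) K" for K
  proof (cases "K \<inter> C = {}")
    case False
    have K': "K \<subseteq> X - S" "conn E K" "\<not> adjacent E K (X - S - K)" using K by (auto simp: component_def)
    have "K \<subseteq> C" using conn_subset_component[OF C K'(2) _ False] K'(1) by blast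
    then have "component E (C - S) K"
      using K' C'(1) unfolding component_def adjacent_def by blast
    then show ?thesis
      unfolding p'_def N'_def by (intro attached_of_splits[OF attC CV S(1,4)])
  next
    case True
    have K': "K \<subseteq> X - S" "conn E K" "\<not> adjacent E K (X - S - K)" using K by (auto simp: component_def)
    have KC: "\<not> adjacent E K C"
    proof
      assume "adjacent E K C"
      then have "adjacent E C K" by (rule adjacent_sym[OF sym])
      then have "adjacent E C (X - C)" by (rule adjacent_mono) (use K' True in auto)
      then show False using C' by blast
    qed
    have "component E X K" using K' KC S(1) unfolding component_def adjacent_def by blast
    then obtain J Q where JQ: "attached n p N K J Q" using att by blast
    have "J \<subseteq> {..<n}" using JQ by (simp add: attached_def)
    moreover have "p' w = p w" if "c \<in> K" "(c, w) \<in> E" for c w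
      using KC that S(1) by (auto simp: p'_def adjacent_def)
    ultimately have "attached (Suc n) p' N' K J Q"
      using JQ unfolding attached_def N'_def by (auto simp: less_Suc_eq)
    then show ?thesis by blast
  qed
  ultimately have "partial_partition (X - S) (Suc n) p' N'"
    unfolding partial_partition_def using X zero_less_Suc[of n] by blast
  then show ?thesis using S C' by blast
qed

lemma partition_exists: "\<exists>n p N. partial_partition {} n p N"
proof -
  have "\<exists>n p N. partial_partition {} n p N" if "partial_partition X n p N" for X n p N
    using that
  proof (induction "card X" arbitrary: X n p N rule: less_induct)
    case less
    show ?case
    proof (cases "X = {}")
      case True
      then show ?thesis using less.prems by blast
    next
      case False
      then obtain S p' N' where S: "S \<subseteq> X" "S \<noteq> {}" "partial_partition (X - S) (Suc n) p' N'"
        using partial_partition_step[OF less.prems] by blast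
      have "finite X" using less.prems fin by (auto simp: partial_partition_def intro: finite_subset)
      then have "card (X - S) < card X" using S by (intro psubset_card_mono) auto
      then show ?thesis using less.hyps S(3) by blast
    qed
  qed
  moreover have "attached 1 p N C {} R" if C: "component E V C" for C p N R
  proof -
    have "w \<in> C" if "c \<in> C" "(c, w) \<in> E" for c w
      using C that edges unfolding component_def adjacent_def by blast
    then show ?thesis by (auto simp: attached_def clique_model_def)
  qed
  then have "partial_partition V 1 (\<lambda>_. 0) (\<lambda>_. {})"
    unfolding partial_partition_def clique_order_def by simp blast
  ultimately show ?thesis by blast
qed

end

section \<open>Finding the excluded minor\<close>

lemma extend_packing:
  assumes E: "sym E" and fin: "finite C" and C: "conn E C" and t: "0 < t"
    and f: "\<forall>i<t. f i \<subseteq> C \<and> conn E (f i)" "disjoint_family_on f {..<t}"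
  obtains g where "\<forall>i<t. f i \<subseteq> g i \<and> conn E (g i)" "disjoint_family_on g {..<t}"
    "(\<Union>i<t. g i) = C"
proof -
  define P where "P g \<longleftrightarrow> (\<forall>i<t. f i \<subseteq> g i \<and> conn E (g i)) \<and> disjoint_family_on g {..<t} \<and>
    (\<Union>i<t. g i) \<subseteq> C" for g
  have "P f" using f by (auto simp: P_def)
  moreover have "card (\<Union>i<t. g i) < Suc (card C)" if "P g" for g
    using that fin by (simp add: P_def less_Suc_eq_le card_mono)
  ultimately obtain g where g: "P g" and max: "\<And>h. P h \<Longrightarrow> card (\<Union>i<t. h i) \<le> card (\<Union>i<t. g i)"
    using ex_has_greatest_nat[of P f "\<lambda>g. card (\<Union>i<t. g i)" "Suc (card C)"] by blast
  have g': "\<And>i. i < t \<Longrightarrow> f i \<subseteq> g i" "\<And>i. i < t \<Longrightarrow> conn E (g i)" "disjoint_family_on g {..<t}"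
      "(\<Union>i<t. g i) \<subseteq> C"
    using g by (simp_all add: P_def)
  have "(\<Union>i<t. g i) = C"
  proof (rule ccontr)
    assume ne: "(\<Union>i<t. g i) \<noteq> C"
    have "g 0 \<noteq> {}" using g'(2)[OF t] by (simp add: conn_def)
    then have "(\<Union>i<t. g i) \<noteq> {}" using t by blast
    then have "adjacent E (\<Union>i<t. g i) (C - (\<Union>i<t. g i))" using connD[OF C g'(4)] ne by blast
    then obtain i a z where i: "i < t" "a \<in> g i" "z \<in> C" "z \<notin> (\<Union>i<t. g i)" "(a, z) \<in> E"
      unfolding adjacent_def by blast
    define h where "h = g(i := insert z (g i))"
    have Uh: "(\<Union>j<t. h j) = insert z (\<Union>j<t. g j)" using i(1) by (auto simp: h_def)
    have "f j \<subseteq> h j \<and> conn E (h j)" if "j < t" for j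
      using g'(1,2)[OF that] conn_insert[OF E g'(2)[OF i(1)] i(2,5)] by (auto simp: h_def)
    moreover have "disjoint_family_on h {..<t}"
      unfolding disjoint_family_on_def
    proof (intro ballI impI)
      fix j k assume jk: "j \<in> {..<t}" "k \<in> {..<t}" "j \<noteq> k"
      have "g j \<inter> g k = {}" using g'(3) jk by (simp add: disjoint_family_on_def)
      moreover have "z \<notin> g j" "z \<notin> g k" using i(4) jk by auto
      ultimately show "h j \<inter> h k = {}" using jk by (auto simp: h_def)
    qed
    moreover have "(\<Union>j<t. h j) \<subseteq> C" using Uh g'(4) i(3) by simp
    ultimately have "P h" by (simp add: P_def)
    then have "card (insert z (\<Union>j<t. g j)) \<le> card (\<Union>j<t. g j)" using max[of h] Uh by simp
    moreover have "finite (\<Union>j<t. g j)" using g'(4) fin by (rule finite_subset)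
    ultimately show False using i(4) by simp
  qed
  then show thesis using g that[of g] by (simp add: P_def)
qed

lemma not_J_minor_free_if_packing:
  assumes G: "pair_graph G" and t: "0 < t"
    and model: "clique_model (parcs G) C I R" "card I = s" "\<And>i. i \<in> I \<Longrightarrow> R i \<subseteq> pverts G"
    and C: "conn (parcs G) C" "C \<subseteq> pverts G"
    and f: "\<And>i. i < t \<Longrightarrow> f i \<subseteq> C" "\<And>i. i < t \<Longrightarrow> conn (parcs G) (f i)"
      "\<And>i j. i < t \<Longrightarrow> j \<in> I \<Longrightarrow> adjacent (parcs G) (f i) (R j)" "disjoint_family_on f {..<t}"
  shows "\<not> J_minor_free s t G"
proof -
  interpret pair_graph G by fact
  note sym = pair_graph_sym[OF G]
  have finC: "finite C" using C(2) pair_finite_verts by (rule finite_subset)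
  have "\<forall>i<t. f i \<subseteq> C \<and> conn (parcs G) (f i)" using f(1,2) by simp
  from extend_packing[OF sym finC C(1) t this f(4)]
  obtain g where "\<forall>i<t. f i \<subseteq> g i \<and> conn (parcs G) (g i)" and
      g34: "disjoint_family_on g {..<t}" "(\<Union>i<t. g i) = C" .
  then have g: "\<And>i. i < t \<Longrightarrow> f i \<subseteq> g i" "\<And>i. i < t \<Longrightarrow> conn (parcs G) (g i)" by simp_all
  have I: "finite I" "\<And>i. i \<in> I \<Longrightarrow> conn (parcs G) (R i)" "\<And>i. i \<in> I \<Longrightarrow> R i \<inter> C = {}"
    "\<And>i j. i \<in> I \<Longrightarrow> j \<in> I \<Longrightarrow> i \<noteq> j \<Longrightarrow> R i \<inter> R j = {} \<and> adjacent (parcs G) (R i) (R j)"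
    using model(1) by (simp_all add: clique_model_def)
  obtain h where "bij_betw h {0..<card I} I" using ex_bij_betw_nat_finite[OF I(1)] by blast
  then have bij: "bij_betw h {0..<s} I" using model(2) by simp
  have h: "h x \<in> I" if "x < s" for x
    using bij_betw_apply[OF bij] that by simp
  have h_inj: "h x \<noteq> h y" if "x < s" "y < s" "x \<noteq> y" for x y
    using inj_onD[OF bij_betw_imp_inj_on[OF bij], of x y] that by auto
  define \<phi> where "\<phi> x = (if x < s then R (h x) else g (x - s))" for x
  define J where "J = \<lparr>pverts = {..<s + t},
    parcs = {(x, y). x < s + t \<and> y < s + t \<and> x \<noteq> y \<and> adjacent (parcs G) (\<phi> x) (\<phi> y)}\<rparr>"
  have gC: "g i \<subseteq> C" if "i < t" for i using g34(2) that by blast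
  have \<phi>_new: "\<phi> x = g (x - s)" "x - s < t" if "x \<in> {s..<s + t}" for x
    using that by (auto simp: \<phi>_def)
  have gR: "R (h x) \<inter> g i = {}" if "x < s" "i < t" for x i
    using I(3)[OF h[OF that(1)]] gC[OF that(2)] by blast
  have symJ: "sym (parcs J)"
    by (rule symI) (use adjacent_sym[OF sym] in \<open>auto simp: J_def\<close>)
  have finJ: "finite (parcs J)"
    by (rule finite_subset[of _ "{..<s + t} \<times> {..<s + t}"]) (auto simp: J_def)
  have "pair_graph J"
    by unfold_locales (use symJ finJ in \<open>auto simp: J_def symmetric_def\<close>)
  moreover have "(u, v) \<in> parcs J" if "u < s" "v < s" "u \<noteq> v" for u v
    using that I(4)[OF h[OF that(1)] h[OF that(2)] h_inj[OF that]] by (simp add: J_def \<phi>_def)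
  moreover have "(u, v) \<in> parcs J" if "u < s" "v \<in> {s..<s + t}" for u v
  proof -
    have v: "v - s < t" using that(2) by auto
    have "adjacent (parcs G) (f (v - s)) (R (h u))" using f(3)[OF v h[OF that(1)]] .
    then have "adjacent (parcs G) (g (v - s)) (R (h u))"
      by (rule adjacent_mono[OF _ g(1)[OF v] order_refl])
    then have "adjacent (parcs G) (\<phi> u) (\<phi> v)"
      using adjacent_sym[OF sym] that by (simp add: \<phi>_def)
    then show ?thesis using that by (simp add: J_def)
  qed
  moreover have "conn (parcs J) {s..<s + t}"
    unfolding conn_def
  proof (intro conjI allI impI)
    show "{s..<s + t} \<noteq> {}" using t by simp
    fix X assume X: "X \<subseteq> {s..<s + t} \<and> X \<noteq> {} \<and> X \<noteq> {s..<s + t}"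
    let ?Y = "\<Union>x\<in>X. \<phi> x"
    have cover: "(\<Union>x\<in>{s..<s + t}. \<phi> x) = C"
    proof -
      have "c \<in> (\<Union>x\<in>{s..<s + t}. \<phi> x)" if c: "c \<in> C" for c
      proof -
        obtain i where "i < t" "c \<in> g i" using c g34(2) by blast
        then have "s + i \<in> {s..<s + t}" "c \<in> \<phi> (s + i)" by (auto simp: \<phi>_def)
        then show ?thesis by blast
      qed
      moreover have "\<phi> x \<subseteq> C" if "x \<in> {s..<s + t}" for x using \<phi>_new[OF that] gC by simp
      ultimately show ?thesis by blast
    qed
    have ne: "\<phi> x \<noteq> {}" if "x \<in> {s..<s + t}" for x
      using g(2)[OF \<phi>_new(2)[OF that]] \<phi>_new(1)[OF that] by (simp add: conn_def)
    have disj: "\<phi> x \<inter> \<phi> y = {}" if "x \<in> {s..<s + t}" "y \<in> {s..<s + t}" "x \<noteq> y" for x y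
    proof -
      have "x - s \<noteq> y - s" using that by auto
      then show ?thesis
        using g34(1) \<phi>_new[OF that(1)] \<phi>_new[OF that(2)] by (simp add: disjoint_family_on_def)
    qed
    obtain x where x: "x \<in> X" "x \<in> {s..<s + t}" using X by blast
    obtain y where y: "y \<notin> X" "y \<in> {s..<s + t}" using X by blast
    have "?Y \<noteq> {}" using ne x by blast
    moreover have "?Y \<subseteq> C" using X cover by blast
    moreover have "\<phi> y \<inter> ?Y = {}" using X y disj[OF y(2)] by blast
    then have "?Y \<noteq> C" using ne[OF y(2)] cover y(2) by blast
    ultimately have "adjacent (parcs G) ?Y (C - ?Y)" using connD[OF C(1)] by blast
    then obtain a c where ac: "a \<in> ?Y" "c \<in> C" "c \<notin> ?Y" "(a, c) \<in> parcs G"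
      by (auto simp: adjacent_def)
    obtain x' where x': "x' \<in> X" "a \<in> \<phi> x'" using ac(1) by blast
    obtain y' where y': "y' \<in> {s..<s + t}" "c \<in> \<phi> y'" using ac(2) cover by blast
    have y'X: "y' \<notin> X" using y'(2) ac(3) by blast
    then have "x' \<noteq> y'" using x'(1) by blast
    moreover have "adjacent (parcs G) (\<phi> x') (\<phi> y')"
      unfolding adjacent_def using x'(2) y'(2) ac(4) by blast
    moreover have "x' \<in> {s..<s + t}" using X x'(1) by blast
    ultimately have "(x', y') \<in> parcs J" using y'(1) by (simp add: J_def)
    then show "adjacent (parcs J) X ({s..<s + t} - X)"
      unfolding adjacent_def using x'(1) y'(1) y'X by blast
  qed
  then have "Digraph_Component.connected (with_proj J \<restriction> {s..<s + t})"
    by (simp add: connected_iff_conn[OF symJ])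
  moreover have "pverts J = {..<s} \<union> {s..<s + t}" by (auto simp: J_def)
  moreover have "{..<s} \<inter> {s..<s + t} = {}" "card {..<s} = s" "card {s..<s + t} = t" by auto
  ultimately have "J \<in> J_class s t"
    unfolding J_class_def
    by (intro CollectI conjI exI[of _ "{..<s}"] exI[of _ "{s..<s + t}"]) auto
  moreover have "is_minor J G"
    unfolding is_minor_def
  proof (intro exI[of _ \<phi>] conjI ballI impI)
    fix x assume x: "x \<in> pverts J"
    have "conn (parcs G) (\<phi> x) \<and> \<phi> x \<subseteq> pverts G"
    proof (cases "x < s")
      case True
      then show ?thesis using I(2) model(3) h by (simp add: \<phi>_def)
    next
      case False
      then have "x \<in> {s..<s + t}" using x by (simp add: J_def)
      from \<phi>_new[OF this] have "\<phi> x = g (x - s)" "conn (parcs G) (g (x - s))" "g (x - s) \<subseteq> C"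
        using g(2) gC by simp_all
      then show ?thesis using C(2) by simp
    qed
    then show "\<phi> x \<subseteq> pverts G" "Digraph_Component.connected (with_proj G \<restriction> \<phi> x)"
      by (simp_all add: connected_iff_conn[OF sym])
    fix y assume y: "y \<in> pverts J" "x \<noteq> y"
    show "\<phi> x \<inter> \<phi> y = {}"
    proof (cases "x < s"; cases "y < s")
      assume xy: "x < s" "y < s"
      have "R (h x) \<inter> R (h y) = {}"
        using I(4)[OF h[OF xy(1)] h[OF xy(2)] h_inj[OF xy y(2)]] ..
      then show ?thesis using xy by (simp add: \<phi>_def)
    next
      assume xy: "x < s" "\<not> y < s"
      then have "R (h x) \<inter> g (y - s) = {}" using y x by (intro gR) (simp_all add: J_def)
      then show ?thesis using xy by (simp add: \<phi>_def)
    next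
      assume xy: "\<not> x < s" "y < s"
      then have "R (h y) \<inter> g (x - s) = {}" using y x by (intro gR) (simp_all add: J_def)
      then show ?thesis using xy by (simp add: \<phi>_def Int_commute)
    next
      assume xy: "\<not> x < s" "\<not> y < s"
      then have "x - s < t" "y - s < t" "x - s \<noteq> y - s" using x y by (auto simp: J_def)
      then have "g (x - s) \<inter> g (y - s) = {}" using g34(1) by (simp add: disjoint_family_on_def)
      then show ?thesis using xy by (simp add: \<phi>_def)
    qed
  next
    fix e assume "e \<in> parcs J"
    then show "case e of (x, y) \<Rightarrow> \<exists>u\<in>\<phi> x. \<exists>v\<in>\<phi> y. (u, v) \<in> parcs G"
      by (auto simp: J_def adjacent_def)
  qed
  ultimately show ?thesis unfolding J_minor_free_def by blast
qed

section \<open>Treewidth of the quotient\<close>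

definition parent_tree :: "nat \<Rightarrow> (nat \<Rightarrow> nat) \<Rightarrow> nat pair_pre_digraph" where
  "parent_tree n par = \<lparr>pverts = {..<n},
     parcs = {(i, j). i < n \<and> j < n \<and> (0 < i \<and> j = par i \<or> 0 < j \<and> i = par j)}\<rparr>"

lemma pair_graph_parent_tree:
  assumes par: "\<And>j. 0 < j \<Longrightarrow> par j < j"
  shows "pair_graph (parent_tree n par)"
proof -
  have fin: "finite (parcs (parent_tree n par))"
    by (rule finite_subset[of _ "{..<n} \<times> {..<n}"]) (auto simp: parent_tree_def)
  have sym: "sym (parcs (parent_tree n par))"
    by (rule symI) (auto simp: parent_tree_def)
  have loop: "fst e \<noteq> snd e" if "e \<in> parcs (parent_tree n par)" for e
    using that par[of "fst e"] par[of "snd e"] by (auto simp: parent_tree_def)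
  show ?thesis
    by unfold_locales
      (use fin sym in \<open>simp_all add: symmetric_def loop\<close>, auto simp: parent_tree_def)
qed

lemma conn_parent_tree:
  assumes par: "\<And>j. 0 < j \<Longrightarrow> par j < j" and A: "A \<subseteq> {..<n}" "a \<in> A"
    and closed: "\<And>j. j \<in> A \<Longrightarrow> j \<noteq> a \<Longrightarrow> 0 < j \<and> par j \<in> A"
  shows "conn (parcs (parent_tree n par)) A"
  unfolding conn_def
proof (intro conjI allI impI)
  show "A \<noteq> {}" using A by blast
  fix X assume X: "X \<subseteq> A \<and> X \<noteq> {} \<and> X \<noteq> A"
  then have "\<exists>z. z \<in> A \<and> (z \<in> X) \<noteq> (a \<in> X)" by blast
  then obtain z where z: "z \<in> A" "(z \<in> X) \<noteq> (a \<in> X)"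
    and least: "\<And>y. y \<in> A \<and> (y \<in> X) \<noteq> (a \<in> X) \<Longrightarrow> z \<le> y"
    using exists_least_iff[of "\<lambda>z. z \<in> A \<and> (z \<in> X) \<noteq> (a \<in> X)"] by (metis not_le)
  have "z \<noteq> a" using z by blast
  then have pz: "0 < z" "par z \<in> A" using closed z(1) by auto
  then have "(par z \<in> X) = (a \<in> X)" using least[of "par z"] par[of z] by fastforce
  moreover have "z < n" "par z < n" using A(1) z(1) pz(2) by auto
  then have "(z, par z) \<in> parcs (parent_tree n par)" "(par z, z) \<in> parcs (parent_tree n par)"
    using pz by (auto simp: parent_tree_def)
  ultimately show "adjacent (parcs (parent_tree n par)) X (A - X)"
    unfolding adjacent_def using z pz(2) by blast
qed

text \<open>Rotate the cycle to start at its largest vertex: both neighbours are then its parent.\<close>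

lemma undirected_tree_parent_tree:
  assumes par: "\<And>j. 0 < j \<Longrightarrow> par j < j" and n: "0 < n"
  shows "undirected_tree (parent_tree n par)"
proof -
  let ?T = "parent_tree n par"
  have pg: "pair_graph ?T" using pair_graph_parent_tree par by blast
  interpret T: pair_graph ?T by fact
  have "par j < n" if "j < n" "0 < j" for j using par[OF that(2)] that(1) by simp
  then have "conn (parcs ?T) (pverts ?T)"
    using par n by (intro conn_parent_tree[where a = 0]) (auto simp: parent_tree_def)
  then have "Digraph_Component.connected (with_proj ?T)"
    using connected_iff_conn[OF pair_graph_sym[OF pg], of "pverts ?T"]
      induce_subgraph_pverts[OF T.pair_wf_digraph] by simp
  moreover have False if cyc: "T.cycle p" and len: "3 \<le> length p" for p
  proof -
    obtain u where u: "T.awalk u p u" "distinct (tl (pawalk_verts u p))" "p \<noteq> []"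
      using cyc by (auto simp: T.cycle_def)
    have cas: "pcas u p u" and arcs: "set p \<subseteq> parcs ?T" using u(1) by (simp_all add: T.awalk_def)
    have dist: "distinct (map snd p)" using u(2) pawalk_verts_eq[OF cas] by simp
    define w where "w = Max (snd ` set p)"
    have "w \<in> snd ` set p" unfolding w_def using u(3) by (intro Max_in) auto
    then obtain e where e: "e \<in> set p" "snd e = w" by blast
    then obtain q r where p: "p = q @ e # r" by (meson split_list)
    have max: "snd x \<le> w" if "x \<in> set p" for x unfolding w_def using that by simp
    define c where "c = r @ q @ [e]"
    have casc: "pcas w c w"
    proof -
      obtain v where "pcas u q v" "pcas v (e # r) u" using cas p by (auto simp: pcas_append)
      then show ?thesis using e(2) unfolding c_def pcas_append by force
    qed
    have "distinct (map snd c)" using dist p by (auto simp: c_def)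
    have setc: "set c = set p" and lenc: "3 \<le> length c" using p len by (auto simp: c_def)
    obtain x m y where c: "c = x # m @ [y]" "m \<noteq> []"
    proof -
      obtain x c' where 1: "c = x # c'" using lenc by (cases c) auto
      obtain m y where 2: "c' = m @ [y]" using 1 lenc by (cases c' rule: rev_cases) auto
      have "m \<noteq> []" using 1 2 lenc by auto
      then show thesis using 1 2 that by blast
    qed
    have xw: "fst x = w" using casc c by simp
    have yw: "snd y = w" using casc c by (auto simp: pcas_append)
    have my: "fst y = snd (last m)"
    proof -
      obtain m' z where m: "m = m' @ [z]" using c(2) by (cases m rule: rev_cases) auto
      show ?thesis using casc c(1) m by (auto simp: pcas_append)
    qed
    have xy: "x \<in> parcs ?T" "y \<in> parcs ?T" "last m \<in> set p" "x \<in> set p"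
      using arcs setc c by auto
    have "snd x \<le> w" "fst y \<le> w" using max[of x] max[of "last m"] xy(3,4) my by auto
    moreover have "fst x \<noteq> snd x" "fst y \<noteq> snd y" using T.pair_no_loops xy(1,2) by auto
    ultimately have "snd x < w" "fst y < w" using xw yw by auto
    then have "snd x = par w" "fst y = par w"
      using xy(1,2) xw yw par[of "snd x"] par[of "fst y"]
      by (auto simp: parent_tree_def split: prod.splits)
    then have "snd x = snd (last m)" using my by simp
    moreover have "snd x \<notin> snd ` set m" using \<open>distinct (map snd c)\<close> c by auto
    ultimately show False using c(2) by (metis image_eqI last_in_set)
  qed
  ultimately show ?thesis using pg unfolding undirected_tree_def by blast
qed

definition order_graph :: "nat \<Rightarrow> (nat \<Rightarrow> nat set) \<Rightarrow> nat pair_pre_digraph" where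
  "order_graph n N = \<lparr>pverts = {..<n},
     parcs = {(i, j). i < n \<and> j < n \<and> (i \<in> N j \<or> j \<in> N i)}\<rparr>"

lemma
  assumes co: "clique_order s n N" and n: "0 < n"
  shows pair_graph_order_graph: "pair_graph (order_graph n N)"
    and treewidth_order_graph: "treewidth (order_graph n N) \<le> int s"
proof -
  let ?H = "order_graph n N"
  have N: "\<And>i j. j < n \<Longrightarrow> i \<in> N j \<Longrightarrow> i < j" and cardN: "\<And>j. j < n \<Longrightarrow> card (N j) \<le> s"
    and clique: "\<And>j a c. j < n \<Longrightarrow> a \<in> N j \<Longrightarrow> c \<in> N j \<Longrightarrow> a < c \<Longrightarrow> a \<in> N c"
    using co by (auto simp: clique_order_def)
  have finN: "finite (N j)" if "j < n" for j
    by (rule finite_subset[of _ "{..<j}"]) (use N that in auto)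
  have fin: "finite (parcs ?H)"
    by (rule finite_subset[of _ "{..<n} \<times> {..<n}"]) (auto simp: order_graph_def)
  have sym: "sym (parcs ?H)" by (rule symI) (auto simp: order_graph_def)
  have loop: "fst e \<noteq> snd e" if "e \<in> parcs ?H" for e
    using that N[of "snd e" "fst e"] N[of "fst e" "snd e"] by (auto simp: order_graph_def)
  show H: "pair_graph ?H"
    by unfold_locales
      (use fin sym in \<open>simp_all add: symmetric_def loop\<close>, auto simp: order_graph_def)
  define par where "par j = (if j < n \<and> N j \<noteq> {} then Max (N j) else 0)" for j
  have Max_N: "Max (N j) \<in> N j" if "j < n" "N j \<noteq> {}" for j using finN that by (intro Max_in)
  have par: "par j < j" if "0 < j" for j
    using Max_N[of j] N[of j "Max (N j)"] that by (auto simp: par_def)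
  let ?T = "parent_tree n par"
  let ?B = "\<lambda>x. insert x (N x)"
  have Tv: "pverts ?T = {..<n}" by (simp add: parent_tree_def)
  have T: "undirected_tree ?T" using undirected_tree_parent_tree[of par n] par n by blast
  then have symT: "sym (parcs ?T)" by (intro pair_graph_sym) (simp add: undirected_tree_def)
  have "tree_decomposition ?H ?T ?B"
    unfolding tree_decomposition_def Tv
  proof (intro conjI ballI)
    show "insert x (N x) \<subseteq> pverts ?H" if "x \<in> {..<n}" for x
      using that N[of x] by (force simp: order_graph_def)
    show "case e of (u, v) \<Rightarrow> \<exists>x\<in>{..<n}. u \<in> ?B x \<and> v \<in> ?B x" if "e \<in> parcs ?H" for e
      using that by (auto simp: order_graph_def)
    show "Digraph_Component.connected (with_proj ?T \<restriction> {x \<in> {..<n}. v \<in> ?B x})"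
      if v: "v \<in> pverts ?H" for v
      unfolding connected_iff_conn[OF symT]
    proof (rule conn_parent_tree[where a = v])
      fix j assume j: "j \<in> {x \<in> {..<n}. v \<in> ?B x}" "j \<noteq> v"
      then have jn: "j < n" and vj: "v \<in> N j" by auto
      have pj: "par j = Max (N j)" using jn vj by (auto simp: par_def)
      have Mj: "Max (N j) \<in> N j" using Max_N[OF jn] vj by blast
      have "v \<le> Max (N j)" using finN[OF jn] vj by (rule Max_ge)
      then have "v = par j \<or> v \<in> N (par j)"
        using clique[OF jn vj Mj] unfolding pj by (cases "v = Max (N j)") simp_all
      moreover have "par j < n" using N[OF jn Mj] jn pj by simp
      ultimately show "0 < j \<and> par j \<in> {x \<in> {..<n}. v \<in> ?B x}" using N[OF jn vj] by auto
    qed (use v par in \<open>auto simp: order_graph_def\<close>)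
  qed (rule T)
  then have "treewidth ?H \<le> decomposition_width ?T ?B" by (rule treewidth_le[OF H])
  moreover have "card (?B x) \<le> Suc s" if "x < n" for x
    using card_insert_le_m1[of "Suc s" "N x" x] cardN[OF that] by simp
  then have "Max ((\<lambda>x. card (?B x)) ` pverts ?T) \<le> Suc s"
    using n unfolding Tv by (intro Max.boundedI) auto
  ultimately show "treewidth ?H \<le> int s" by (simp add: decomposition_width_def)
qed

lemma isomorphic_to_subgraphI:
  assumes G: "pair_graph G" and H: "pair_graph H" and inj: "inj_on \<phi> (pverts G)"
    and verts: "\<phi> ` pverts G \<subseteq> pverts H"
    and arcs: "\<And>u v. (u, v) \<in> parcs G \<Longrightarrow> (\<phi> u, \<phi> v) \<in> parcs H"
  shows "isomorphic_to_subgraph G H"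
proof -
  interpret G: pair_graph G by fact
  interpret H: pair_graph H by fact
  define f where "f = \<lparr>iso_verts = \<phi>, iso_arcs = map_prod \<phi> \<phi>, iso_head = snd, iso_tail = fst\<rparr>"
  have "inj_on (map_prod \<phi> \<phi>) (parcs G)"
    by (rule inj_on_subset[OF map_prod_inj_on[OF inj inj]]) (auto dest: G.in_arcsD1 G.in_arcsD2)
  then have "pre_digraph.digraph_isomorphism (with_proj G) f"
    unfolding G.digraph_isomorphism_def using inj G.wf_digraph_axioms by (simp add: f_def)
  moreover have "subgraph (app_iso f (with_proj G)) (with_proj H)"
    unfolding subgraph_def
  proof (intro conjI)
    show "wf_digraph (app_iso f (with_proj G))"
      by unfold_locales (auto simp: app_iso_def f_def dest: G.in_arcsD1 G.in_arcsD2)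
    show "compatible (with_proj H) (app_iso f (with_proj G))"
      by (simp add: compatible_def app_iso_def f_def)
    show "wf_digraph (with_proj H)" by (rule H.wf_digraph_axioms)
  qed (use verts arcs in \<open>auto simp: app_iso_def f_def\<close>)
  ultimately show ?thesis unfolding isomorphic_to_subgraph_def digraph_iso_def by blast
qed

theorem theorem14:
  fixes s t :: nat and G :: "'a pair_pre_digraph"
  assumes "s \<ge> 2" and "t \<ge> 2"
    and "pair_graph G"
    and "J_minor_free s t G"
  shows "\<exists>H :: nat pair_pre_digraph. pair_graph H \<and> treewidth H \<le> int s \<and>
    isomorphic_to_subgraph G
      (H \<boxtimes> complete_graph (nat ((treewidth G + 1) * (int t - 1))))"
proof -
  interpret G: pair_graph G by fact
  obtain T :: "nat pair_pre_digraph" and B where td: "tree_decomposition G T B"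
    and width: "decomposition_width T B = treewidth G"
    using treewidth_attained[OF \<open>pair_graph G\<close>] by blast
  define b where "b = Max ((\<lambda>x. card (B x)) ` pverts T)"
  define m where "m = nat ((treewidth G + 1) * (int t - 1))"
  have "finite (pverts T)"
    using td by (simp add: tree_decomposition_def undirected_tree_def pair_graph_def
        pair_digraph_def pair_fin_digraph.pair_finite_verts)
  then have bag: "card (B x) \<le> b" if "x \<in> pverts T" for x
    unfolding b_def using that by (intro Max_ge) auto
  have "(treewidth G + 1) * (int t - 1) = int ((t - 1) * b)"
    using width \<open>t \<ge> 2\<close> by (simp add: decomposition_width_def b_def of_nat_diff)
  then have m: "m = (t - 1) * b" unfolding m_def by (simp only: nat_int)
  interpret sparse_graph "parcs G" "pverts G" b s t
  proof
    show "sym (parcs G)" using pair_graph_sym \<open>pair_graph G\<close> by blast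
    show "finite (pverts G)" by (rule G.pair_finite_verts)
    show "parcs G \<subseteq> pverts G \<times> pverts G" using G.in_arcsD1 G.in_arcsD2 by auto
    show "t \<ge> 2" by fact
    show "\<exists>S U. card S \<le> b \<and> cuts_off (parcs G) (pverts G) \<F> S U"
      if F: "\<F> \<noteq> {}" "\<And>A. A \<in> \<F> \<Longrightarrow> conn (parcs G) A \<and> A \<subseteq> pverts G" for \<F>
    proof -
      obtain x U where "x \<in> pverts T" "cuts_off (parcs G) (pverts G) \<F> (B x) U"
        using tree_decomposition_separation[OF \<open>pair_graph G\<close> td F(1)] F(2) by blast
      then show ?thesis using bag by blast
    qed
    show False
      if "clique_model (parcs G) C I R" "card I = s" "conn (parcs G) C" "C \<subseteq> pverts G"
        "\<And>i. i < t \<Longrightarrow> f i \<subseteq> C \<and> conn (parcs G) (f i) \<and> (\<forall>j\<in>I. adjacent (parcs G) (f i) (R j))"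
        "disjoint_family_on f {..<t}" "\<And>i. i \<in> I \<Longrightarrow> R i \<subseteq> pverts G" for C I R f
    proof -
      have "\<not> J_minor_free s t G"
        by (rule not_J_minor_free_if_packing[where C = C and I = I and R = R and f = f])
          (use that \<open>t \<ge> 2\<close> \<open>pair_graph G\<close> in simp_all)
      then show False using \<open>J_minor_free s t G\<close> by blast
    qed
  qed
  obtain n p N where "partial_partition {} n p N" using partition_exists by blast
  then have n: "0 < n" "clique_order s n N" and p: "\<And>v. v \<in> pverts G \<Longrightarrow> p v < n"
    and size: "\<And>i. i < n \<Longrightarrow> card {v \<in> pverts G. p v = i} \<le> (t - 1) * b"
    and edge: "\<And>u v. u \<in> pverts G \<Longrightarrow> v \<in> pverts G \<Longrightarrow> (u, v) \<in> parcs G \<Longrightarrow>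
      p u = p v \<or> p u \<in> N (p v) \<or> p v \<in> N (p u)"
    by (simp_all add: partial_partition_def)
  have "\<exists>q. q ` {v \<in> pverts G. p v = i} \<subseteq> {..<m} \<and> inj_on q {v \<in> pverts G. p v = i}"
    if "i < n" for i
    using size[OF that] G.pair_finite_verts by (intro card_le_inj) (simp_all add: m)
  then obtain q where q: "\<And>i. i < n \<Longrightarrow> q i ` {v \<in> pverts G. p v = i} \<subseteq> {..<m} \<and>
      inj_on (q i) {v \<in> pverts G. p v = i}"
    by metis
  define \<phi> where "\<phi> v = (p v, q (p v) v)" for v
  let ?H = "order_graph n N"
  have H: "pair_graph ?H" by (rule pair_graph_order_graph[OF n(2,1)])
  have K: "pair_graph (complete_graph m)"
    by unfold_locales
      (auto simp: complete_graph_def symmetric_def intro!: symI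
        intro: finite_subset[of _ "{..<m} \<times> {..<m}"])
  have qm: "q (p v) v < m" if "v \<in> pverts G" for v using q[OF p[OF that]] that by auto
  have inj: "inj_on \<phi> (pverts G)"
  proof (rule inj_onI)
    fix u v assume uv: "u \<in> pverts G" "v \<in> pverts G" "\<phi> u = \<phi> v"
    then have "inj_on (q (p u)) {w \<in> pverts G. p w = p u}" using q p by blast
    then show "u = v" by (rule inj_onD) (use uv in \<open>auto simp: \<phi>_def\<close>)
  qed
  have "isomorphic_to_subgraph G (?H \<boxtimes> complete_graph m)"
  proof (rule isomorphic_to_subgraphI[OF \<open>pair_graph G\<close> pair_graph_strong_product[OF H K] inj])
    show "\<phi> ` pverts G \<subseteq> pverts (?H \<boxtimes> complete_graph m)"
      using p qm by (auto simp: strong_product_def order_graph_def complete_graph_def \<phi>_def)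
    fix u v assume uv: "(u, v) \<in> parcs G"
    have V: "u \<in> pverts G" "v \<in> pverts G" using G.in_arcsD1[OF uv] G.in_arcsD2[OF uv] .
    have "\<phi> u \<noteq> \<phi> v" using inj_onD[OF inj _ V] G.pair_no_loops[OF uv] by auto
    then show "(\<phi> u, \<phi> v) \<in> parcs (?H \<boxtimes> complete_graph m)"
      using edge[OF V uv] p[OF V(1)] p[OF V(2)] qm[OF V(1)] qm[OF V(2)]
      by (auto simp: strong_product_def order_graph_def complete_graph_def \<phi>_def)
  qed
  then show ?thesis using H treewidth_order_graph[OF n(2,1)] unfolding m_def by blast
qed

end
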